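(* (a) Let $\mathcal{C}=\{\sigma:\mathbf{S}(\mathbf{i}(\mathbf{S}(\sigma)))=\mathrm{id}\}$, with the insertion rule Smallest. Then deleting the smallest entry of any $\pi\in\mathcal{C}$ of size $\ge2$ and normalizing gives an element of $\mathcal{C}$; the permutation $1$ has label $(2,0)$; and every $\pi\in\mathcal{C}$ with label $(r,s)$ has children whose multiset of labels is exactly $\{(i+1,r+s-i):1\le i\le r\}\cup\{(r,s-j):1\le j\le s\}$. Here the label of $\pi$ of size $n$ is $(r,s)$ where $r$ is the index of the second element of the first ascent of $\pi$ (i.e. $r=i+1$ for the smallest $i$ with $\pi_i<\pi_{i+1}$), or $r=n+1$ if $\pi=n(n-1)\cdots1$, and $s$ is the number of active sites at positions $t\ge r$. (b) Let $\mathcal{D}=Av(2\text{-}14\text{-}3,\,2\text{-}41\text{-}3)$, with the insertion rule Largest. Then deleting the largest entry of any $\pi\in\mathcal{D}$ of size $\ge 2$ gives an element of $\mathcal{D}$; the permutation $1$ has label $(2,0)$; and every $\pi\in\mathcal{D}$ with label $(r,s)$ has children whose multiset of labels is exactly $\{(i+1,r+s-i):1\le i\le r\}\cup\{(r,s-j):1\le j\le s\}$. Here, if $\pi$ has size $n$ and $\pi_m=n$, then $r$ is $1$ plus the number of active sites at positions $t<m$, and $s$ is the number of active sites at positions $t\ge m$ minus $1$. Consequently both generating trees are described by the same rewriting system with root $(2,0)$ and rule $(r,s)\rightsquigarrow\{(i+1,r+s-i)\}_{1\le i\le r}\cup\{(r,s-j)\}_{1\le j\le s}$.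
   Context: Permutations of size $n$ are words $\pi_1\cdots\pi_n$; $\mathrm{id}=12\cdots n$. Stack sorting: $\mathbf{S}(\varepsilon)=\varepsilon$, $\mathbf{S}(LmR)=\mathbf{S}(L)\mathbf{S}(R)m$ with $m$ the maximum letter of $LmR$; $\mathbf{i}$ is the inverse permutation. Sites of $\pi$ of size $n$ are positions $t\in\{0,\dots,n\}$ (between $\pi_t$ and $\pi_{t+1}$; $t=0$ is the beginning, $t=n$ the end). Insertion rule Smallest: inserting in site $t$ gives the permutation $(\pi_1+1)\cdots(\pi_t+1)\,1\,(\pi_{t+1}+1)\cdots(\pi_n+1)$. Insertion rule Largest: inserting in site $t$ gives $\pi_1\cdots\pi_t\,(n+1)\,\pi_{t+1}\cdots\pi_n$. For a class $\mathcal{E}$ and a given rule, a site is active if the result lies in $\mathcal{E}$, and the children of $\pi$ are the results of inserting in its active sites. A permutation $\sigma$ contains the dashed pattern $2\text{-}14\text{-}3$ if there are indices $i<j<j+1<k$ with $\sigma_j<\sigma_i<\sigma_k<\sigma_{j+1}$, and contains $2\text{-}41\text{-}3$ if there are indices $i<j<j+1<k$ with $\sigma_{j+1}<\sigma_i<\sigma_k<\sigma_j$; $Av(\cdot,\cdot)$ is the set of permutations containing neither. *)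

theory Defs
  imports "HOL-Combinatorics.Multiset_Permutations" "HOL-Library.Multiset"
begin

(* A permutation of size n is the list of its letters, a distinct list with letter set {1..n};
   the letter in 1-based position p is w ! (p - 1). *)
definition is_perm :: "nat list \<Rightarrow> bool" where
  "is_perm w \<longleftrightarrow> w \<in> permutations_of_set {1..length w}"

definition id_perm :: "nat \<Rightarrow> nat list" where
  "id_perm n = [1..<Suc n]"

(* For a letter v of w: the 1-based position of its first occurrence. *)
definition pos :: "nat list \<Rightarrow> nat \<Rightarrow> nat" where
  "pos w v = Suc (length (takeWhile (\<lambda>x. x \<noteq> v) w))"

definition inverse_perm :: "nat list \<Rightarrow> nat list" where
  "inverse_perm w = map (pos w) [1..<Suc (length w)]"

(* S(L m R) = S(L) S(R) m, splitting w at the first occurrence of its maximum m. *)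
function stack_sort :: "nat list \<Rightarrow> nat list" where
  "stack_sort [] = []"
| "w \<noteq> [] \<Longrightarrow> stack_sort w =
     stack_sort (takeWhile (\<lambda>x. x \<noteq> Max (set w)) w) @
     stack_sort (tl (dropWhile (\<lambda>x. x \<noteq> Max (set w)) w)) @ [Max (set w)]"
  by auto
termination
proof (relation "measure length", goal_cases)
  case 1
  show ?case by simp
next
  case (2 w)
  have "Max (set w) \<in> set w"
    using 2 by simp
  then have "length (takeWhile (\<lambda>x. x \<noteq> Max (set w)) w) < length w"
    by (metis (mono_tags, lifting) length_takeWhile_le nat_less_le set_takeWhileD takeWhile_eq_take take_all order_refl)
  then show ?case by simp
next
  case (3 w)
  have "length (dropWhile (\<lambda>x. x \<noteq> Max (set w)) w) \<le> length w"
    by (rule length_dropWhile_le)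
  moreover have "length w > 0"
    using 3 by simp
  ultimately have "length (dropWhile (\<lambda>x. x \<noteq> Max (set w)) w) - 1 < length w"
    by linarith
  then show ?case by simp
qed

definition class_C :: "nat list set" where
  "class_C = {w. is_perm w \<and>
     stack_sort (inverse_perm (stack_sort w)) = id_perm (length w)}"

(* Dashed patterns: the two middle letters have to be adjacent. The indices are 0-based. *)
definition contains_2_14_3 :: "nat list \<Rightarrow> bool" where
  "contains_2_14_3 w \<longleftrightarrow> (\<exists>i j k. i < j \<and> j + 1 < k \<and> k < length w \<and>
     w ! j < w ! i \<and> w ! i < w ! k \<and> w ! k < w ! (j + 1))"

definition contains_2_41_3 :: "nat list \<Rightarrow> bool" where
  "contains_2_41_3 w \<longleftrightarrow> (\<exists>i j k. i < j \<and> j + 1 < k \<and> k < length w \<and>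
     w ! (j + 1) < w ! i \<and> w ! i < w ! k \<and> w ! k < w ! j)"

definition class_D :: "nat list set" where
  "class_D = {w. is_perm w \<and> \<not> contains_2_14_3 w \<and> \<not> contains_2_41_3 w}"

(* Site t lies after the first t letters. *)
definition insert_smallest :: "nat \<Rightarrow> nat list \<Rightarrow> nat list" where
  "insert_smallest t w = map Suc (take t w) @ [1] @ map Suc (drop t w)"

definition insert_largest :: "nat \<Rightarrow> nat list \<Rightarrow> nat list" where
  "insert_largest t w = take t w @ [Suc (length w)] @ drop t w"

definition delete_smallest :: "nat list \<Rightarrow> nat list" where
  "delete_smallest w = map (\<lambda>x. x - 1) (filter (\<lambda>x. x \<noteq> 1) w)"

definition delete_largest :: "nat list \<Rightarrow> nat list" where
  "delete_largest w = filter (\<lambda>x. x \<noteq> length w) w"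

definition active_sites ::
  "nat list set \<Rightarrow> (nat \<Rightarrow> nat list \<Rightarrow> nat list) \<Rightarrow> nat list \<Rightarrow> nat set" where
  "active_sites E ins w = {t. t \<le> length w \<and> ins t w \<in> E}"

definition children ::
  "nat list set \<Rightarrow> (nat \<Rightarrow> nat list \<Rightarrow> nat list) \<Rightarrow> nat list \<Rightarrow> nat list set" where
  "children E ins w = (\<lambda>t. ins t w) ` active_sites E ins w"

(* With i the 0-based index of the first letter of the first ascent, its second letter has
   1-based index i + 2. *)
definition first_ascent_pos :: "nat list \<Rightarrow> nat" where
  "first_ascent_pos w =
     (if w = rev (id_perm (length w)) then length w + 1
      else (LEAST i. Suc i < length w \<and> w ! i < w ! Suc i) + 2)"

definition label_C :: "nat list \<Rightarrow> nat \<times> nat" where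
  "label_C w = (let r = first_ascent_pos w in
     (r, card {t \<in> active_sites class_C insert_smallest w. r \<le> t}))"

(* For nonempty w in class_D the site just after the largest letter is active, so the
   natural-number subtraction does not truncate. *)
definition label_D :: "nat list \<Rightarrow> nat \<times> nat" where
  "label_D w = (let m = pos w (length w); A = active_sites class_D insert_largest w in
     (1 + card {t \<in> A. t < m}, card {t \<in> A. m \<le> t} - 1))"

fun succ_rule :: "nat \<times> nat \<Rightarrow> (nat \<times> nat) multiset" where
  "succ_rule (r, s) =
     {# (i + 1, r + s - i). i \<in># mset_set {1..r} #} +
     {# (r, s - j). j \<in># mset_set {1..s} #}"

(* Possibly infinite, finitely branching rooted trees with unordered children. Since the
   children form a multiset, equality of trees is isomorphism of labelled rooted trees. *)
codatatype 'a tree = Node (node_label: 'a) (subtrees: "'a tree multiset")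

primcorec grow :: "('a \<Rightarrow> 'a multiset) \<Rightarrow> 'a \<Rightarrow> 'a tree" where
  "grow f x = Node x (image_mset (grow f) (f x))"

definition generating_tree ::
  "nat list set \<Rightarrow> (nat \<Rightarrow> nat list \<Rightarrow> nat list) \<Rightarrow> nat list tree" where
  "generating_tree E ins = grow (\<lambda>w. mset_set (children E ins w)) [1]"

(* grow rewr root_label is the tree of the rewriting system: a node labelled l has one
   child for each element of rewr l, counted with multiplicity. *)
definition described_by ::
  "nat list tree \<Rightarrow> (nat list \<Rightarrow> 'l) \<Rightarrow> 'l \<Rightarrow> ('l \<Rightarrow> 'l multiset) \<Rightarrow> bool" where
  "described_by T lab root_label rewr \<longleftrightarrow> map_tree lab T = grow rewr root_label"

end

theory Submission
  imports Defs
begin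

text \<open>
  The stack sorted word \<open>S(w)\<close> inverts exactly the pairs \<open>x < y\<close> for which some \<open>z > y\<close> stands
  between \<open>y\<close> and \<open>x\<close> in \<open>w\<close>, and \<open>S(v) = id\<close> iff \<open>v\<close> avoids 231. Hence \<open>w\<close> lies in \<open>class_C\<close> iff
  \<open>S(w)\<close> avoids 312. It follows that the site between \<open>u\<close> and \<open>v\<close> in \<open>u @ v\<close> is active iff every \<open>c\<close>
  that precedes a larger letter in \<open>u\<close> is smaller than the last letter of \<open>u\<close> and all letters of \<open>v\<close>.
  All sites before the first ascent are active, and inserting 1 at \<open>t\<close> keeps the status of the sites
  to the right and, if there is an ascent to the left of \<open>t\<close>, kills the sites between that ascent
  and the new letter.

  For \<open>class_D\<close>, a site to the left of the largest letter is active iff its neighbours are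
  left-to-right maxima, and inserting a new largest letter does not affect the sites to its right.

  In both cases, a child whose site is the \<open>i\<close>-th of the \<open>r + s\<close> active ones has the label
  \<open>(i + 1, r + s - i)\<close> if \<open>i \<le> r\<close> and \<open>(r, r + s - i)\<close> otherwise.
\<close>

section \<open>Trees and rewriting systems\<close>

lemma rel_mset_image_image:
  assumes "\<And>x. x \<in># M \<Longrightarrow> R (g x) (h x)"
  shows "rel_mset R (image_mset g M) (image_mset h M)"
  using assms by (induction M) (auto intro: rel_mset_Zero rel_mset_Plus)

text \<open>Coinduction over the pairs of trees grown from \<open>x\<close> and from
  \<open>lab x\<close> with \<open>x\<close> in \<open>X\<close>. The invariant \<open>X\<close> has
  to be closed under \<open>f\<close>, since labels are known to follow \<open>g\<close> only inside
  it.\<close>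

lemma map_tree_grow:
  assumes "x \<in> X"
    and "\<And>x. x \<in> X \<Longrightarrow> set_mset (f x) \<subseteq> X"
    and "\<And>x. x \<in> X \<Longrightarrow> image_mset lab (f x) = g (lab x)"
  shows "map_tree lab (grow f x) = grow g (lab x)"
  using assms(1)
proof (coinduction arbitrary: x rule: tree.coinduct)
  case (Eq_tree x)
  have "subtrees (grow g (lab x)) = image_mset (\<lambda>y. grow g (lab y)) (f x)"
    using assms(3)[OF Eq_tree, symmetric] by (simp add: image_mset.compositionality o_def)
  then show ?case
    using assms(2)[OF Eq_tree]
    by (auto simp: tree.map_sel image_mset.compositionality o_def intro!: rel_mset_image_image)
qed

text \<open>The rank is strictly increasing on \<open>A\<close>, hence injective, and an injection
  between finite sets of equal size is onto.\<close>

lemma bij_betw_rank: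
  fixes A :: "nat set"
  assumes "finite A"
  shows "bij_betw (\<lambda>t. card {u \<in> A. u \<le> t}) A {1..card A}"
proof -
  let ?rk = "\<lambda>t. card {u \<in> A. u \<le> t}"
  have less: "?rk x < ?rk y" if "y \<in> A" "x < y" for x y
  proof (rule psubset_card_mono)
    have "{u \<in> A. u \<le> x} \<subseteq> {u \<in> A. u \<le> y}" "y \<in> {u \<in> A. u \<le> y}" "y \<notin> {u \<in> A. u \<le> x}"
      using that by auto
    then show "{u \<in> A. u \<le> x} \<subset> {u \<in> A. u \<le> y}" by blast
  qed (use assms in auto)
  have inj: "inj_on ?rk A"
    by (rule inj_onI) (metis less less_irrefl nat_neq_iff)
  have "?rk ` A \<subseteq> {1..card A}"
  proof clarify
    fix t assume "t \<in> A"
    then have "?rk t > 0" "?rk t \<le> card A"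
      using assms by (auto simp: card_gt_0_iff intro: card_mono)
    then show "?rk t \<in> {1..card A}" by simp
  qed
  moreover have "card (?rk ` A) = card {1..card A}"
    using inj by (simp add: card_image)
  ultimately show ?thesis
    using inj by (simp add: bij_betw_def card_subset_eq)
qed

text \<open>The counting argument shared by both classes: the labels of the children depend only on
  the rank of the active site, and the ranks run through \<open>{1..r + s}\<close>. Ranks up to
  \<open>r\<close> yield the first family of the rule, rank \<open>r + j\<close> yields the
  \<open>j\<close>-th member of the second.\<close>

lemma image_mset_rank_succ_rule:
  fixes A :: "nat set"
  assumes "finite A" and "card A = r + s"
    and "\<And>t. t \<in> A \<Longrightarrow> fst (lab t) =
           (if card {u \<in> A. u \<le> t} \<le> r then card {u \<in> A. u \<le> t} + 1 else r)"
    and "\<And>t. t \<in> A \<Longrightarrow> snd (lab t) = card {u \<in> A. t < u}"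
  shows "image_mset lab (mset_set A) = succ_rule (r, s)"
proof -
  let ?rk = "\<lambda>t. card {u \<in> A. u \<le> t}"
  let ?g = "\<lambda>i. (if i \<le> r then i + 1 else r, r + s - i)"
  have "lab t = ?g (?rk t)" if "t \<in> A" for t
  proof -
    have "A = {u \<in> A. u \<le> t} \<union> {u \<in> A. t < u}" by auto
    then have "card A = ?rk t + card {u \<in> A. t < u}"
      using assms(1) by (subst card_Un_disjoint[symmetric]) auto
    then show ?thesis
      using assms(2-4) that by (simp add: prod_eq_iff)
  qed
  then have "image_mset lab (mset_set A) = image_mset ?g (image_mset ?rk (mset_set A))"
    using assms(1) by (auto simp: image_mset.compositionality o_def intro!: image_mset_cong)
  also have "image_mset ?rk (mset_set A) = mset_set {1..r + s}"
    using bij_betw_rank[OF assms(1)] assms(2)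
    by (metis bij_betw_def image_mset_mset_set)
  also have "{1..r + s} = {1..r} \<union> (\<lambda>j. r + j) ` {1..s}"
    using image_add_atLeastAtMost[of r 1 s] by (auto simp: add.commute)
  also have "mset_set \<dots> = mset_set {1..r} + image_mset (\<lambda>j. r + j) (mset_set {1..s})"
    by (subst mset_set_Union) (auto simp: image_mset_mset_set)
  also have "image_mset ?g \<dots> = succ_rule (r, s)"
    by (auto simp: image_mset.compositionality o_def intro!: arg_cong2[where f="(+)"] image_mset_cong)
  finally show ?thesis .
qed

section \<open>Relative order of letters under stack sorting\<close>

text \<open>Order of occurrence between letters instead of indices, which behaves well under
  concatenation and injective renaming; on distinct words it is a strict linear order.\<close>

fun before :: "'a list \<Rightarrow> 'a \<Rightarrow> 'a \<Rightarrow> bool" where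
  "before [] x y \<longleftrightarrow> False"
| "before (a # w) x y \<longleftrightarrow> x = a \<and> y \<in> set w \<or> before w x y"

lemma before_in_set: "before w x y \<Longrightarrow> x \<in> set w \<and> y \<in> set w"
  by (induction w) auto

lemma before_append:
  "before (u @ v) x y \<longleftrightarrow> before u x y \<or> before v x y \<or> x \<in> set u \<and> y \<in> set v"
  by (induction u) auto

lemma before_map: "before (map f w) p q \<longleftrightarrow> (\<exists>x y. before w x y \<and> p = f x \<and> q = f y)"
  by (induction w) auto

lemma before_map_inj: "inj f \<Longrightarrow> before (map f w) (f x) (f y) \<longleftrightarrow> before w x y"
  by (auto simp: before_map inj_eq)

lemma before_irrefl: "distinct w \<Longrightarrow> \<not> before w x x"
  by (induction w) auto

lemma before_antisym: "distinct w \<Longrightarrow> before w x y \<Longrightarrow> \<not> before w y x"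
  by (induction w) (auto dest: before_in_set)

lemma before_trans: "distinct w \<Longrightarrow> before w x y \<Longrightarrow> before w y z \<Longrightarrow> before w x z"
  by (induction w) (auto dest: before_in_set)

lemma before_linear:
  "x \<in> set w \<Longrightarrow> y \<in> set w \<Longrightarrow> x \<noteq> y \<Longrightarrow> before w x y \<or> before w y x"
  by (induction w) auto

lemma sorted_wrt_iff_before: "sorted_wrt P w \<longleftrightarrow> (\<forall>x y. before w x y \<longrightarrow> P x y)"
  by (induction w) auto

lemma before_upt: "before [m..<n] x y \<longleftrightarrow> m \<le> x \<and> x < y \<and> y < n"
  by (induction n) (auto simp: before_append)

lemma pos_less_iff_before:
  assumes "distinct w" "x \<in> set w" "y \<in> set w"
  shows "pos w x < pos w y \<longleftrightarrow> before w x y"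
  using assms by (induction w) (auto simp: pos_def dest: before_in_set)

declare stack_sort.simps(2) [simp del]

lemma stack_sort_split:
  assumes "\<forall>x \<in> set u. x < m" "\<forall>x \<in> set v. x < m"
  shows "stack_sort (u @ m # v) = stack_sort u @ stack_sort v @ [m]"
proof -
  have m: "Max (set (u @ m # v)) = m"
    using assms by (auto intro!: Max_eqI)
  have "takeWhile (\<lambda>x. x \<noteq> m) (u @ m # v) = u" "dropWhile (\<lambda>x. x \<noteq> m) (u @ m # v) = m # v"
    using assms(1) by (auto simp: takeWhile_append dropWhile_append)
  then show ?thesis
    by (subst stack_sort.simps) (simp_all only: m, auto)
qed

text \<open>Follows the recursion of stack sorting: a nonempty word is cut at its maximum, and
  distinctness makes the letters on both sides strictly smaller.\<close>

lemma max_split_induct [consumes 1, case_names Nil split]: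
  fixes w :: "'a::linorder list"
  assumes "distinct w" "P []"
    and "\<And>u m v. distinct (u @ m # v) \<Longrightarrow> \<forall>x \<in> set u. x < m \<Longrightarrow> \<forall>x \<in> set v. x < m \<Longrightarrow>
           P u \<Longrightarrow> P v \<Longrightarrow> P (u @ m # v)"
  shows "P w"
  using assms(1)
proof (induction w rule: length_induct)
  case (1 w)
  show ?case
  proof (cases "w = []")
    case True
    then show ?thesis using assms(2) by simp
  next
    case False
    then obtain u v where w: "w = u @ Max (set w) # v"
      by (metis List.finite_set Max_in set_empty split_list)
    let ?m = "Max (set w)"
    have d: "distinct (u @ ?m # v)" using w 1(2) by simp
    have "x < ?m" if "x \<in> set u \<union> set v" for x
    proof -
      have "x \<in> set w" using that by (subst w) auto
      then have "x \<le> ?m" by simp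
      moreover have "x \<noteq> ?m" using that d by auto
      ultimately show ?thesis by simp
    qed
    moreover have "length u < length w" "length v < length w"
      by (subst w, simp)+
    ultimately have "P (u @ ?m # v)"
      using d 1(1) by (intro assms(3)) auto
    then show ?thesis using w by simp
  qed
qed

lemma stack_sort_permutes:
  assumes "distinct w"
  shows "set (stack_sort w) = set w \<and> distinct (stack_sort w)"
  using assms by (induction w rule: max_split_induct) (auto simp: stack_sort_split)

text \<open>Induction on the cut at the maximum \<open>m\<close>. Letters of \<open>u\<close>
  precede letters of \<open>v\<close> in the sorted word, and \<open>m\<close> is then a larger
  letter between them in \<open>w\<close>. The letter \<open>m\<close> itself goes to the end. For
  two letters on the same side, \<open>m\<close> does not stand between them, so the induction
  hypothesis decides.\<close>

lemma before_stack_sort_inversion: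
  assumes "distinct w" "x < y"
  shows "before (stack_sort w) y x \<longleftrightarrow> (\<exists>z > y. before w y z \<and> before w z x)"
  using assms
proof (induction w rule: max_split_induct)
  case (split u m v)
  have s: "set (stack_sort u) = set u" "set (stack_sort v) = set v"
    using split.hyps(1) stack_sort_permutes by auto
  show ?case (is "?l \<longleftrightarrow> ?r")
  proof
    assume ?l
    then show ?r
      using split s
      by (auto simp: stack_sort_split before_append dest: before_in_set)
  next
    assume ?r
    then obtain z where z: "z > y" "before (u @ m # v) y z" "before (u @ m # v) z x" by blast
    then show ?l
      using split s
      by (auto simp: stack_sort_split before_append dest: before_in_set)
  qed
qed simp

section \<open>Class C through the inversions of the stack sorted word\<close>

lemma is_perm_iff: "is_perm w \<longleftrightarrow> distinct w \<and> set w = {1..length w}"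
  by (auto simp: is_perm_def permutations_of_set_def)

text \<open>The sorted word is the identity iff it has no inversion, and an inversion comes from
  letters \<open>y z x\<close> forming the pattern 231.\<close>

lemma stack_sort_eq_id_perm_iff:
  assumes "is_perm w"
  shows "stack_sort w = id_perm (length w) \<longleftrightarrow>
    (\<forall>x y z. x < y \<and> y < z \<longrightarrow> \<not> (before w y z \<and> before w z x))"
proof -
  have w: "distinct w" "set w = {1..length w}"
    using assms by (auto simp: is_perm_iff)
  note s = stack_sort_permutes[OF w(1)]
  have "stack_sort w = id_perm (length w) \<longleftrightarrow> sorted (stack_sort w)"
    using w s
    by (metis (no_types, lifting) atLeastLessThanSuc_atLeastAtMost distinct_upt id_perm_def
        set_upt sorted_distinct_set_unique sorted_upt)
  also have "\<dots> \<longleftrightarrow> (\<forall>x y. x < y \<longrightarrow> \<not> before (stack_sort w) y x)"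
    unfolding sorted_wrt_iff_before by (meson leD leI)
  also have "\<dots> \<longleftrightarrow> (\<forall>x y z. x < y \<and> y < z \<longrightarrow> \<not> (before w y z \<and> before w z x))"
    using before_stack_sort_inversion[OF w(1)] by blast
  finally show ?thesis .
qed

lemma pos_in_range:
  assumes "v \<in> set w"
  shows "pos w v \<in> {1..length w}"
  using assms by (induction w) (auto simp: pos_def)

lemma inverse_perm_props:
  assumes "is_perm w"
  shows "length (inverse_perm w) = length w" "is_perm (inverse_perm w)"
proof -
  show len: "length (inverse_perm w) = length w"
    by (simp add: inverse_perm_def del: upt_Suc)
  have w: "distinct w" "set w = {1..length w}"
    using assms by (auto simp: is_perm_iff)
  have inj: "inj_on (pos w) (set w)"
  proof (rule inj_onI, rule ccontr)
    fix x y assume "x \<in> set w" "y \<in> set w" "pos w x = pos w y" "x \<noteq> y"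
    then show False
      using before_linear[of x w y] pos_less_iff_before[OF w(1)] by (metis less_irrefl)
  qed
  have up: "set [1..<Suc (length w)] = set w"
    by (simp only: w(2) set_upt atLeastLessThanSuc_atLeastAtMost)
  have "set (inverse_perm w) = pos w ` set w"
    using up by (simp only: inverse_perm_def set_map)
  also have "\<dots> = {1..length w}"
  proof (rule card_subset_eq)
    show "pos w ` set w \<subseteq> {1..length w}" using pos_in_range by blast
    show "card (pos w ` set w) = card {1..length w}"
      using inj w(1) by (simp add: card_image distinct_card)
  qed simp
  finally have "set (inverse_perm w) = {1..length w}" .
  moreover have "distinct (inverse_perm w)"
    using inj up by (simp only: inverse_perm_def distinct_map distinct_upt)
  ultimately show "is_perm (inverse_perm w)"
    by (simp add: is_perm_iff len)
qed

text \<open>Taking inverses turns the pattern 231 into its inverse 312, which occurs here as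
  \<open>c a b\<close>.\<close>

lemma stack_sort_inverse_perm_iff:
  assumes "is_perm w"
  shows "stack_sort (inverse_perm w) = id_perm (length w) \<longleftrightarrow>
    \<not> (\<exists>a b c. a < b \<and> b < c \<and> before w c a \<and> before w a b)" (is "_ \<longleftrightarrow> \<not> ?R")
proof -
  have w: "distinct w" "set w = {1..length w}"
    using assms by (auto simp: is_perm_iff)
  \<comment> \<open>The \<open>a\<close>-th letter of the inverse is \<open>pos w a\<close>, so
    order of occurrence there is order of values in \<open>w\<close>.\<close>
  have bi: "before (inverse_perm w) p q \<longleftrightarrow>
    (\<exists>a b. a \<in> set w \<and> b \<in> set w \<and> a < b \<and> p = pos w a \<and> q = pos w b)" for p q
    unfolding inverse_perm_def before_map before_upt w(2)
    by (intro arg_cong[where f=Ex] ext) auto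
  have "stack_sort (inverse_perm w) = id_perm (length w) \<longleftrightarrow>
    \<not> (\<exists>x y z. x < y \<and> y < z \<and> before (inverse_perm w) y z \<and> before (inverse_perm w) z x)"
    using stack_sort_eq_id_perm_iff[OF inverse_perm_props(2)[OF assms]] inverse_perm_props(1)[OF assms]
    by auto
  also have "(\<exists>x y z. x < y \<and> y < z \<and> before (inverse_perm w) y z \<and> before (inverse_perm w) z x) \<longleftrightarrow> ?R"
    (is "?L \<longleftrightarrow> _")
  proof
    assume ?L
    then obtain x y z a b b' c where *: "x < y" "y < z" "y = pos w a" "z = pos w b" "a < b"
        "z = pos w b'" "x = pos w c" "b' < c"
        and m: "a \<in> set w" "b \<in> set w" "b' \<in> set w" "c \<in> set w"
      unfolding bi by blast
    \<comment> \<open>Both letters have the same position \<open>z\<close> in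
      \<open>w\<close>.\<close>
    have "b = b'"
      using * m before_linear[of b w b'] pos_less_iff_before[OF w(1)] by (metis less_irrefl)
    then show ?R
      using * m pos_less_iff_before[OF w(1)] by metis
  next
    assume ?R
    then obtain a b c where *: "a < b" "b < c" "before w c a" "before w a b" by blast
    then have "a \<in> set w" "b \<in> set w" "c \<in> set w" by (auto dest: before_in_set)
    then show ?L
      unfolding bi using * pos_less_iff_before[OF w(1)] by metis
  qed
  finally show ?thesis .
qed

text \<open>For \<open>x < y\<close> this says that \<open>y\<close> precedes \<open>x\<close> in
  \<open>stack_sort w\<close>, but in terms of \<open>w\<close> alone, so that the effect of
  inserting a letter can be read off without sorting.\<close>

definition stack_inversion :: "nat list \<Rightarrow> nat \<Rightarrow> nat \<Rightarrow> bool" where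
  "stack_inversion w y x \<longleftrightarrow> (\<exists>z > y. before w y z \<and> before w z x)"

text \<open>Membership amounts to the sorted word avoiding 312. In an occurrence
  \<open>c a b\<close> the pairs \<open>(c, a)\<close> and \<open>(c, b)\<close> are inversions
  while \<open>(b, a)\<close> is not, so inversions suffice to express it.\<close>

lemma class_C_iff:
  "w \<in> class_C \<longleftrightarrow> is_perm w \<and>
    (\<forall>a b c. a < b \<and> b < c \<and> stack_inversion w c a \<and> stack_inversion w c b \<longrightarrow> stack_inversion w b a)"
proof (cases "is_perm w")
  case True
  then have w: "distinct w" "set w = {1..length w}"
    by (auto simp: is_perm_iff)
  note s = stack_sort_permutes[OF w(1)]
  have len: "length (stack_sort w) = length w"
    using s w(1) by (metis distinct_card)
  have "is_perm (stack_sort w)"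
    using s w by (simp add: is_perm_iff len)
  then have 1: "w \<in> class_C \<longleftrightarrow>
      \<not> (\<exists>a b c. a < b \<and> b < c \<and> before (stack_sort w) c a \<and> before (stack_sort w) a b)"
    using True stack_sort_inverse_perm_iff[of "stack_sort w"] by (simp add: class_C_def len)
  have inv: "before (stack_sort w) y x \<longleftrightarrow> stack_inversion w y x" if "x < y" for x y
    using before_stack_sort_inversion[OF w(1) that] by (simp add: stack_inversion_def)
  have "before (stack_sort w) c a \<and> before (stack_sort w) a b \<longleftrightarrow>
      stack_inversion w c a \<and> stack_inversion w c b \<and> \<not> stack_inversion w b a"
    if "a < b" "b < c" for a b c
  proof -
    let ?S = "stack_sort w"
    have "a < c" using that by simp
    \<comment> \<open>That \<open>c\<close> precedes \<open>b\<close> follows by transitivity; by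
      linearity, \<open>a\<close> precedes \<open>b\<close> iff \<open>b\<close> does not precede
      \<open>a\<close>.\<close>
    have "before ?S c a \<and> before ?S a b \<longleftrightarrow> before ?S c a \<and> before ?S c b \<and> \<not> before ?S b a"
      using s before_trans[of ?S c a b] before_antisym[of ?S a b] before_linear[of a ?S b] that(1)
        before_in_set[of ?S c a] before_in_set[of ?S c b] by auto
    then show ?thesis
      using inv[OF that(1)] inv[OF that(2)] inv[OF \<open>a < c\<close>] by simp
  qed
  then show ?thesis
    using True unfolding 1 by blast
qed (simp add: class_C_def)

section \<open>The generating tree of class C\<close>

text \<open>For empty \<open>u\<close>, where \<open>last u\<close> is unspecified, the condition
  holds vacuously.\<close>

definition C_site :: "nat list \<Rightarrow> nat list \<Rightarrow> bool" where
  "C_site u v \<longleftrightarrow> (\<forall>c z. c < z \<and> before u c z \<longrightarrow> c < last u \<and> (\<forall>b \<in> set v. c < b))"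

lemma before_last:
  assumes "distinct u" "x \<in> set u" "x \<noteq> last u"
  shows "before u x (last u)"
  using assms by (induction u) (auto split: if_splits)

lemma not_before_last:
  assumes "distinct u"
  shows "\<not> before u (last u) y"
  using assms by (induction u) (auto split: if_splits)

lemma is_perm_insert_one:
  assumes "is_perm (u @ v)"
  shows "is_perm (map Suc u @ 1 # map Suc v)"
proof -
  have uv: "distinct (u @ v)" "set u \<union> set v = {1..length u + length v}"
    using assms by (auto simp: is_perm_iff)
  have "set (map Suc u @ 1 # map Suc v) = insert 1 (Suc ` (set u \<union> set v))" by auto
  also have "\<dots> = {1..length (map Suc u @ 1 # map Suc v)}"
    unfolding uv(2) image_Suc_atLeastAtMost by auto
  finally have "set (map Suc u @ 1 # map Suc v) = {1..length (map Suc u @ 1 # map Suc v)}" .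
  moreover have "0 \<notin> set u \<union> set v"
    unfolding uv(2) by simp
  then have "distinct (map Suc u @ 1 # map Suc v)"
    using uv(1) by (auto simp: distinct_map)
  ultimately show ?thesis
    unfolding is_perm_iff by blast
qed

text \<open>The new 1 is never the larger letter that witnesses an inversion, so inversions among
  old letters persist. An inversion of \<open>y\<close> with the new 1 arises exactly when a larger
  letter follows \<open>y\<close> within \<open>u\<close>. What remains to be excluded is an
  occurrence of 312 whose smallest letter is the new 1, and this is the site condition.\<close>

lemma class_C_insert_one_iff:
  assumes "is_perm (u @ v)"
  shows "map Suc u @ 1 # map Suc v \<in> class_C \<longleftrightarrow> u @ v \<in> class_C \<and> C_site u v"
proof -
  let ?w = "u @ v" let ?w' = "map Suc u @ 1 # map Suc v"
  have d: "distinct ?w" and z: "0 \<notin> set ?w"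
    using assms unfolding is_perm_iff by auto
  \<comment> \<open>Zero is excluded because its shift would be the inserted 1.\<close>
  have bSS: "before ?w' (Suc x) (Suc y) \<longleftrightarrow> before ?w x y" if "x \<noteq> 0" "y \<noteq> 0" for x y
    using that z by (auto simp: before_append before_map_inj dest: before_in_set)
  have inv_SS: "stack_inversion ?w' (Suc y) (Suc x) \<longleftrightarrow> stack_inversion ?w y x" if "y \<noteq> 0" "x \<noteq> 0" for x y
  proof
    assume "stack_inversion ?w' (Suc y) (Suc x)"
    then obtain z where z: "z > y" "before ?w' (Suc y) (Suc z)" "before ?w' (Suc z) (Suc x)"
      unfolding stack_inversion_def by (metis Suc_less_eq2)
    then show "stack_inversion ?w y x"
      using that bSS unfolding stack_inversion_def by auto
  next
    assume "stack_inversion ?w y x"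
    then obtain z where "z > y" "before ?w y z" "before ?w z x"
      unfolding stack_inversion_def by blast
    then show "stack_inversion ?w' (Suc y) (Suc x)"
      using that bSS unfolding stack_inversion_def by (intro exI[of _ "Suc z"]) auto
  qed
  have inv_1: "stack_inversion ?w' (Suc y) 1 \<longleftrightarrow> (\<exists>z > y. before u y z)" if "y \<noteq> 0" for y
  proof
    assume "stack_inversion ?w' (Suc y) 1"
    then obtain x where x: "x > y" "before ?w' (Suc y) (Suc x)" "before ?w' (Suc x) 1"
      unfolding stack_inversion_def by (metis Suc_less_eq2)
    have "x \<in> set u"
      using x z by (auto simp: before_append before_map dest: before_in_set)
    then have "x \<notin> set v" using d by auto
    then have "before u y x"
      using x that by (auto simp: before_append before_map_inj dest: before_in_set)
    then show "\<exists>z > y. before u y z" using x by blast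
  next
    assume "\<exists>z > y. before u y z"
    then obtain z where "z > y" "before u y z" by blast
    then show "stack_inversion ?w' (Suc y) 1"
      unfolding stack_inversion_def
      by (intro exI[of _ "Suc z"]) (auto simp: before_append before_map_inj dest: before_in_set)
  qed
  have no0: "\<not> stack_inversion ?w' y 0" "\<not> stack_inversion ?w y 0" for y
    using z by (auto simp: stack_inversion_def dest!: before_in_set)
  \<comment> \<open>Occurrences of 312 are divided by their smallest letter \<open>a\<close>: old
    letters give \<open>?R1\<close>, the new 1 gives \<open>?R2\<close>.\<close>
  have "(\<forall>a b c. a < b \<and> b < c \<and> stack_inversion ?w' c a \<and> stack_inversion ?w' c b \<longrightarrow> stack_inversion ?w' b a)
    \<longleftrightarrow> (\<forall>a b c. a < b \<and> b < c \<and> stack_inversion ?w c a \<and> stack_inversion ?w c b \<longrightarrow> stack_inversion ?w b a) \<and>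
       (\<forall>b c. 0 < b \<and> b < c \<and> (\<exists>z > c. before u c z) \<and> stack_inversion ?w c b \<longrightarrow> (\<exists>z > b. before u b z))"
    (is "?L \<longleftrightarrow> ?R1 \<and> ?R2")
  proof (intro iffI conjI allI impI)
    fix a b c assume L: ?L and *: "a < b \<and> b < c \<and> stack_inversion ?w c a \<and> stack_inversion ?w c b"
    then have "a \<noteq> 0" using no0 by (metis (lifting))
    then show "stack_inversion ?w b a"
      using L[rule_format, of "Suc a" "Suc b" "Suc c"] *
        inv_SS[of b a] inv_SS[of c a] inv_SS[of c b] by simp
  next
    fix b c assume L: ?L and *: "0 < b \<and> b < c \<and> (\<exists>z > c. before u c z) \<and> stack_inversion ?w c b"
    show "\<exists>z > b. before u b z"
      using * L[rule_format, of 1 "Suc b" "Suc c"] inv_1[of b] inv_1[of c] inv_SS[of c b] by simp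
  next
    fix a b c assume R: "?R1 \<and> ?R2"
      and *: "a < b \<and> b < c \<and> stack_inversion ?w' c a \<and> stack_inversion ?w' c b"
    have "a \<noteq> 0" using * no0 by (metis (lifting))
    then have "a \<noteq> 0" "b \<noteq> 0" "c \<noteq> 0" using * by auto
    then obtain a' b' c' where S: "a = Suc a'" "b = Suc b'" "c = Suc c'"
      by (meson not0_implies_Suc)
    have lt: "a' < b'" "b' < c'" using * S by auto
    show "stack_inversion ?w' b a"
    proof (cases "a' = 0")
      case True
      then show ?thesis
        using conjunct2[OF R, rule_format, of b' c'] * S lt inv_1[of b'] inv_1[of c'] inv_SS[of c' b']
        by simp
    next
      case False
      then have "stack_inversion ?w b' a'"
        using conjunct1[OF R, rule_format, of a' b' c'] * S lt inv_SS[of c' b'] inv_SS[of c' a'] by simp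
      then show ?thesis using False S lt inv_SS[of b' a'] by simp
    qed
  qed
  moreover have "?R2 \<longleftrightarrow> C_site u v"
  proof
    assume R: ?R2
    show "C_site u v"
      unfolding C_site_def
    proof (intro allI impI, elim conjE)
      fix c z assume cz: "c < z" "before u c z"
      \<comment> \<open>Here \<open>z\<close> stands between \<open>c\<close> and \<open>b\<close>,
        so \<open>(c, b)\<close> is an inversion and \<open>?R2\<close> asks for a larger letter
        after \<open>b\<close> in \<open>u\<close>. There is none if \<open>b\<close> ends
        \<open>u\<close> or lies in \<open>v\<close>.\<close>
      have False if b: "b \<in> set v \<or> b = last u" "b \<le> c" for b
      proof -
        have u: "c \<in> set u" "z \<in> set u" "u \<noteq> []"
          using cz by (auto dest: before_in_set)
        have "b \<noteq> c"
          using b u d cz not_before_last[of u z] by auto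
        then have bc: "b < c" using b by simp
        have "before ?w z b"
          using b u d bc cz before_last[of u z] by (auto simp: before_append)
        moreover have "before ?w c z" using cz by (simp add: before_append)
        ultimately have "stack_inversion ?w c b"
          using cz unfolding stack_inversion_def by blast
        moreover have "b > 0"
          using z b u by (metis Un_iff last_in_set neq0_conv set_append)
        ultimately obtain z' where "before u b z'"
          using R bc cz by blast
        then show False
          using b d not_before_last[of u z'] by (auto dest: before_in_set)
      qed
      then show "c < last u \<and> (\<forall>b \<in> set v. c < b)" using leI by blast
    qed
  next
    assume C: "C_site u v"
    show ?R2
    proof (intro allI impI, elim conjE exE)
      fix b c z assume *: "b < c" "stack_inversion ?w c b" "z > c" "before u c z"
      then have lt: "c < last u" "\<forall>b \<in> set v. c < b"
        using C unfolding C_site_def by blast+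
      have "b \<in> set ?w" using *(2) by (auto simp: stack_inversion_def dest!: before_in_set)
      \<comment> \<open>Since \<open>b < c\<close>, it cannot lie in \<open>v\<close>; and
        \<open>last u\<close> exceeds \<open>c\<close>, hence \<open>b\<close>, so it is the larger
        letter sought.\<close>
      then have "b \<in> set u" using lt * by auto
      then show "\<exists>z > b. before u b z"
        using lt * d before_last[of u b] by (intro exI[of _ "last u"]) auto
    qed
  qed
  ultimately show ?thesis
    using assms is_perm_insert_one[OF assms] unfolding class_C_iff by (simp only: simp_thms)
qed

section \<open>Active sites, first ascents and labels in class C\<close>

lemma insert_smallest_append: "insert_smallest (length u) (u @ v) = map Suc u @ 1 # map Suc v"
  by (simp add: insert_smallest_def)

lemma length_insert_smallest: "length (insert_smallest t w) = Suc (length w)"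
  by (auto simp: insert_smallest_def)

lemma class_C_is_perm: "w \<in> class_C \<Longrightarrow> is_perm w"
  by (simp add: class_C_def)

lemma active_sites_C:
  assumes "w \<in> class_C"
  shows "active_sites class_C insert_smallest w = {t. t \<le> length w \<and> C_site (take t w) (drop t w)}"
proof -
  have "insert_smallest t w \<in> class_C \<longleftrightarrow> C_site (take t w) (drop t w)" for t
    using class_C_insert_one_iff[of "take t w" "drop t w"] class_C_is_perm[OF assms] assms
    by (simp add: insert_smallest_def)
  then show ?thesis by (auto simp: active_sites_def)
qed

text \<open>The word arises by inserting 1 into its reduced word, so the insertion criterion can be
  read backwards.\<close>

lemma class_C_delete_smallest:
  assumes "w \<in> class_C" "w \<noteq> []"
  shows "delete_smallest w \<in> class_C"
proof -
  have w: "distinct w" "set w = {1..length w}"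
    using assms by (auto simp: class_C_def is_perm_iff)
  have "1 \<in> set w" using assms(2) by (auto simp: w(2) Suc_le_eq)
  then obtain u0 v0 where uv0: "w = u0 @ 1 # v0" by (meson split_list)
  let ?u = "map (\<lambda>x. x - 1) u0" let ?v = "map (\<lambda>x. x - 1) v0"
  have pos: "x > 0" if "x \<in> set u0 \<union> set v0" for x
  proof -
    have "x \<in> set w" using that uv0 by auto
    then show ?thesis unfolding w(2) by simp
  qed
  have S: "map Suc ?u = u0" "map Suc ?v = v0"
    using pos by (auto simp: o_def intro!: map_idI)
  have ne: "1 \<notin> set u0" "1 \<notin> set v0" using w(1) uv0 by auto
  have "filter (\<lambda>x. x \<noteq> 1) u0 = u0" "filter (\<lambda>x. x \<noteq> 1) v0 = v0"
    using ne by (metis (mono_tags, lifting) filter_True)+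
  then have del: "delete_smallest w = ?u @ ?v"
    unfolding delete_smallest_def uv0 by (simp del: One_nat_def)
  have "distinct (?u @ ?v)"
  proof -
    have "distinct (map Suc (?u @ ?v))" using w(1) uv0 S by simp
    then show ?thesis by (simp only: distinct_map)
  qed
  moreover have "set (?u @ ?v) = {1..length (?u @ ?v)}"
  proof -
    have len: "length w = Suc (length (?u @ ?v))" by (simp add: uv0)
    have "Suc ` set (?u @ ?v) = set (map Suc ?u) \<union> set (map Suc ?v)"
      by (simp only: set_append set_map image_Un)
    also have "\<dots> = insert 1 (set u0 \<union> set v0) - {1}"
      unfolding S using ne by blast
    also have "insert 1 (set u0 \<union> set v0) = set w"
      by (simp add: uv0)
    also have "set w - {1} = Suc ` {1..length (?u @ ?v)}"
      unfolding w(2) len image_Suc_atLeastAtMost by (auto simp del: length_append)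
    finally show ?thesis by (simp only: inj_image_eq_iff inj_Suc)
  qed
  ultimately have "is_perm (?u @ ?v)" unfolding is_perm_iff by blast
  from class_C_insert_one_iff[OF this] show ?thesis
    using assms(1) del S uv0 by simp
qed

text \<open>Trades the least index for a condition on prefixes: a prefix decreases until it contains
  the first ascent. For the decreasing word of size \<open>n\<close> all \<open>n + 1\<close>
  prefixes qualify, in agreement with the default value of the label.\<close>

lemma sorted_wrt_take_first_ascent:
  assumes "is_perm w"
  shows "{t. t \<le> length w \<and> sorted_wrt (>) (take t w)} = {..<first_ascent_pos w}"
proof -
  have d: "distinct w" and w: "set w = {1..length w}"
    using assms by (auto simp: is_perm_iff)
  have dec: "sorted_wrt (>) (rev (id_perm n))" for n
    by (simp add: id_perm_def sorted_wrt_rev del: upt_Suc)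
  have tr: "sorted_wrt (>) xs \<longleftrightarrow> (\<forall>i. Suc i < length xs \<longrightarrow> xs ! i > xs ! Suc i)" for xs :: "nat list"
    by (rule sorted_wrt_iff_nth_Suc_transp) (auto simp: transp_def)
  show ?thesis
  proof (cases "w = rev (id_perm (length w))")
    case True
    then have "sorted_wrt (>) w" using dec by metis
    then have "sorted_wrt (>) (take t w)" for t by (rule sorted_wrt_take)
    then show ?thesis using True by (auto simp: first_ascent_pos_def)
  next
    case False
    have "\<not> sorted_wrt (>) w"
    proof
      assume s: "sorted_wrt (>) w"
      have "sorted (rev w)"
        using s by (simp add: sorted_wrt_rev) (auto elim: sorted_wrt_mono_rel[rotated])
      moreover have "sorted (id_perm (length w))" "distinct (id_perm (length w))"
        "set (id_perm (length w)) = set (rev w)"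
        by (auto simp: id_perm_def w simp del: upt_Suc)
      ultimately have "rev w = id_perm (length w)"
        using d by (intro sorted_distinct_set_unique) auto
      then show False using False by (metis rev_rev_ident)
    qed
    then have ex: "\<exists>i. Suc i < length w \<and> w ! i < w ! Suc i"
      using d unfolding tr by (metis Suc_lessD lessI less_irrefl linorder_neqE_nat nth_eq_iff_index_eq)
    define i where "i = (LEAST i. Suc i < length w \<and> w ! i < w ! Suc i)"
    have i: "Suc i < length w" "w ! i < w ! Suc i"
      using LeastI_ex[OF ex] unfolding i_def by auto
    have least: "w ! j > w ! Suc j" if "j < i" for j
    proof -
      have "\<not> w ! j < w ! Suc j"
        using not_less_Least[of j "\<lambda>i. Suc i < length w \<and> w ! i < w ! Suc i"] that i(1)
        unfolding i_def[symmetric] by simp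
      moreover have "w ! j \<noteq> w ! Suc j"
        using d that i(1) by (simp add: nth_eq_iff_index_eq)
      ultimately show ?thesis by simp
    qed
    \<comment> \<open>As \<open>i\<close> is 0-based, the prefix of length \<open>i + 2\<close> is
      the first to contain both letters of the ascent.\<close>
    have "t \<le> length w \<and> sorted_wrt (>) (take t w) \<longleftrightarrow> t < i + 2" for t
    proof
      assume t: "t \<le> length w \<and> sorted_wrt (>) (take t w)"
      show "t < i + 2"
      proof (rule ccontr)
        assume "\<not> t < i + 2"
        then have "Suc i < length (take t w)" using t by auto
        then have "take t w ! i > take t w ! Suc i" using t unfolding tr by blast
        then show False using i \<open>\<not> t < i + 2\<close> by auto
      qed
    next
      assume "t < i + 2"
      then show "t \<le> length w \<and> sorted_wrt (>) (take t w)"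
        using i(1) least by (auto simp: tr)
    qed
    moreover have "first_ascent_pos w = i + 2"
      using False by (simp add: first_ascent_pos_def i_def)
    ultimately show ?thesis by auto
  qed
qed

lemma not_decreasing_iff_before:
  assumes "distinct u"
  shows "\<not> sorted_wrt (>) u \<longleftrightarrow> (\<exists>c z. before u c z \<and> c < (z::nat))"
  unfolding sorted_wrt_iff_before using before_irrefl[OF assms] by (metis less_asym nat_neq_iff)

text \<open>The new 1 does precede larger letters, but it is smaller than every shifted letter and
  so meets the condition. A nonempty \<open>u2\<close> keeps it from being the last letter of the
  left part.\<close>

lemma C_site_insert_one_right:
  assumes "is_perm (u1 @ u2 @ v)" "u2 \<noteq> []"
  shows "C_site (map Suc u1 @ 1 # map Suc u2) (map Suc v) \<longleftrightarrow> C_site (u1 @ u2) v"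
proof -
  have "set (u1 @ u2 @ v) = {1..length (u1 @ u2 @ v)}"
    using assms(1) unfolding is_perm_iff by blast
  then have z: "x > 0" if "x \<in> set u1 \<union> set u2 \<union> set v" for x
    using that by (metis Un_iff atLeastAtMost_iff not_one_le_zero neq0_conv set_append)
  have l: "last (map Suc u1 @ 1 # map Suc u2) = Suc (last (u1 @ u2))" "last (u1 @ u2) = last u2"
    using assms(2) by (auto simp: last_map)
  show ?thesis
  proof
    assume L: "C_site (map Suc u1 @ 1 # map Suc u2) (map Suc v)"
    show "C_site (u1 @ u2) v"
      unfolding C_site_def
    proof (intro allI impI)
      fix c x assume "c < x \<and> before (u1 @ u2) c x"
      then have "Suc c < Suc x \<and> before (map Suc u1 @ 1 # map Suc u2) (Suc c) (Suc x)"
        by (auto simp: before_append before_map_inj)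
      from L[unfolded C_site_def, THEN spec, THEN spec, THEN mp, OF this]
      show "c < last (u1 @ u2) \<and> (\<forall>b \<in> set v. c < b)"
        unfolding l by simp
    qed
  next
    assume R: "C_site (u1 @ u2) v"
    show "C_site (map Suc u1 @ 1 # map Suc u2) (map Suc v)"
      unfolding C_site_def
    proof (intro allI impI)
      fix c x assume cx: "c < x \<and> before (map Suc u1 @ 1 # map Suc u2) c x"
      show "c < last (map Suc u1 @ 1 # map Suc u2) \<and> (\<forall>b \<in> set (map Suc v). c < b)"
      proof (cases "c = 1")
        case True
        then show ?thesis using z assms(2) by (simp add: last_map)
      next
        case False
        then obtain c' x' where "c = Suc c'" "x = Suc x'" "c' < x'" "before (u1 @ u2) c' x'"
          using cx by (auto simp: before_append before_map)
        then show ?thesis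
          using R[unfolded C_site_def, THEN spec, THEN spec, THEN mp, of c' x'] unfolding l by simp
      qed
    qed
  qed
qed

text \<open>Sites beyond the insertion point move up by one. Site \<open>t\<close> is left out,
  because it splits into the two sites adjacent to the new 1.\<close>

lemma active_sites_C_child:
  assumes "w \<in> class_C" "t \<in> active_sites class_C insert_smallest w" "t < u"
  shows "Suc u \<in> active_sites class_C insert_smallest (insert_smallest t w) \<longleftrightarrow>
    u \<in> active_sites class_C insert_smallest w"
proof (cases "u \<le> length w")
  case True
  have w': "insert_smallest t w \<in> class_C" "length (insert_smallest t w) = Suc (length w)" "t \<le> length w"
    using assms(2) by (auto simp: active_sites_def insert_smallest_def)
  let ?u1 = "take t w" let ?u2 = "take (u - t) (drop t w)" let ?v = "drop u w"
  have tk: "take u w = ?u1 @ ?u2"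
    using assms(3) take_add[of t "u - t" w] by simp
  have w: "w = ?u1 @ ?u2 @ ?v"
    using tk by (metis append.assoc append_take_drop_id)
  have iw: "insert_smallest t w = (map Suc ?u1 @ 1 # map Suc ?u2) @ map Suc ?v"
    using insert_smallest_append[of ?u1 "?u2 @ ?v"] w w'(3) by simp
  have "length (map Suc ?u1 @ 1 # map Suc ?u2) = Suc u"
    using assms(3) True by simp
  then have "take (Suc u) (insert_smallest t w) = map Suc ?u1 @ 1 # map Suc ?u2"
    "drop (Suc u) (insert_smallest t w) = map Suc ?v"
    unfolding iw by (metis append_eq_conv_conj)+
  moreover have "?u2 \<noteq> []" using assms(3) True by simp
  moreover have "is_perm (?u1 @ ?u2 @ ?v)"
    using class_C_is_perm[OF assms(1)] w by simp
  ultimately show ?thesis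
    using C_site_insert_one_right True w' tk
    by (simp add: active_sites_C[OF assms(1)] active_sites_C[OF w'(1)])
next
  case False
  then show ?thesis by (simp add: active_sites_def length_insert_smallest)
qed

text \<open>The new 1 prolongs a decreasing prefix, and any letter after it creates an
  ascent.\<close>

lemma sorted_wrt_greater_child:
  assumes "is_perm w" "t \<le> length w" "j \<le> Suc (length w)"
  shows "sorted_wrt (>) (take j (insert_smallest t w)) \<longleftrightarrow>
    sorted_wrt (>) (take (min j t) w) \<and> j \<le> Suc t"
proof -
  have z: "0 \<notin> set w" using assms(1) unfolding is_perm_iff by auto
  have S: "sorted_wrt (>) (map Suc xs) \<longleftrightarrow> sorted_wrt (>) xs" for xs
    by (simp add: sorted_wrt_map)
  consider "j \<le> t" | "j = Suc t" | "j > Suc t" by linarith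
  then show ?thesis
  proof cases
    case 1
    then have "take j (insert_smallest t w) = map Suc (take j w)"
      using assms by (simp add: insert_smallest_def take_map min_def)
    then show ?thesis using 1 S by (simp add: min_def)
  next
    case 2
    then have "take j (insert_smallest t w) = map Suc (take t w) @ [1]"
      using assms by (simp add: insert_smallest_def)
    moreover have "\<forall>x \<in> set (take t w). 0 < x"
      using z by (metis in_set_takeD neq0_conv)
    ultimately show ?thesis using 2 S by (simp add: sorted_wrt_append)
  next
    case 3
    then obtain k where k: "j = Suc (Suc (t + k))" by (metis Suc_lessE add_Suc less_natE)
    then have "take j (insert_smallest t w) = map Suc (take t w) @ 1 # map Suc (take (Suc k) (drop t w))"
      using assms by (simp add: insert_smallest_def take_map)
    moreover have "drop t w \<noteq> []" using k assms by auto
    then obtain y ys where "drop t w = y # ys" by (cases "drop t w") auto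
    ultimately show ?thesis using k by (auto simp: sorted_wrt_append)
  qed
qed

text \<open>If \<open>t < r\<close>, the letters before the new 1 decrease and the first ascent is
  completed at index \<open>t + 2\<close>, which for \<open>t = length w\<close> is the default of
  the decreasing word. If \<open>r <= t\<close>, the old first ascent stays and the sites from there
  up to the new 1 become inactive. Either way the counted sites are the shifts of the active sites
  beyond \<open>t\<close>.\<close>

lemma label_C_child:
  assumes w: "w \<in> class_C" and t: "t \<in> active_sites class_C insert_smallest w"
  defines "r \<equiv> first_ascent_pos w" and "A \<equiv> active_sites class_C insert_smallest w"
  shows "label_C (insert_smallest t w) = (if t < r then t + 2 else r, card {u \<in> A. t < u})"
proof -
  let ?w = "insert_smallest t w" let ?A = "active_sites class_C insert_smallest ?w"
  have w': "?w \<in> class_C" "length ?w = Suc (length w)" "t \<le> length w"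
    using t by (auto simp: active_sites_def insert_smallest_def)
  note p = class_C_is_perm[OF w] and p' = class_C_is_perm[OF w'(1)]
  have d: "distinct w" "distinct ?w" using p p' by (auto simp: is_perm_iff)
  have fa: "j < r \<longleftrightarrow> j \<le> length w \<and> sorted_wrt (>) (take j w)" for j
    using sorted_wrt_take_first_ascent[OF p] unfolding r_def by blast
  have fa': "j < first_ascent_pos ?w \<longleftrightarrow> j \<le> Suc (length w) \<and> sorted_wrt (>) (take j ?w)" for j
    using sorted_wrt_take_first_ascent[OF p'] unfolding w'(2) by blast
  have "j < first_ascent_pos ?w \<longleftrightarrow> j < (if t < r then t + 2 else r)" for j
  proof (cases "t < r")
    case True
    then have "sorted_wrt (>) (take t w)" using fa by blast
    then have "sorted_wrt (>) (take (min j t) w)"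
      by (metis min.commute sorted_wrt_take take_take)
    then show ?thesis
      using True sorted_wrt_greater_child[OF p w'(3)] w'(3) unfolding fa' by auto
  next
    case False
    then have "\<not> sorted_wrt (>) (take t w)" using fa w'(3) by blast
    then have lt: "j < t" if "sorted_wrt (>) (take (min j t) w)"
      using that by (metis linorder_not_less min.absorb2)
    have eq: "j < (if t < r then t + 2 else r) \<longleftrightarrow> j < r" using False by simp
    have "sorted_wrt (>) (take (min j t) w)" if "sorted_wrt (>) (take j w)"
      using sorted_wrt_take[OF that, of t] by (simp add: min.commute)
    then have "j < first_ascent_pos ?w \<longleftrightarrow> j < r"
      unfolding fa fa' using lt sorted_wrt_greater_child[OF p w'(3), of j] w'(3)
      by (cases "j < t") (auto simp: min_def)
    then show ?thesis using eq by simp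
  qed
  then have "{..<first_ascent_pos ?w} = {..<if t < r then t + 2 else r}"
    by (simp only: lessThan_def)
  then have r': "first_ascent_pos ?w = (if t < r then t + 2 else r)"
    by (simp only: lessThan_eq_iff)
  \<comment> \<open>The smaller letter of an increasing pair before such a site would have to be
    below the inserted 1, which ends the prefix or lies to the right of it.\<close>
  have inactive: "u \<notin> ?A" if "r \<le> u" "u \<le> t + 1" "r \<le> t" for u
  proof
    assume "u \<in> ?A"
    then have C: "C_site (take u ?w) (drop u ?w)"
      using active_sites_C[OF w'(1)] by blast
    have "u \<le> Suc (length w)" using that w'(3) by simp
    moreover have "\<not> u < first_ascent_pos ?w" using that r' by simp
    ultimately have "\<not> sorted_wrt (>) (take u ?w)" using fa' by blast
    then obtain c z where cz: "before (take u ?w) c z" "c < z"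
      using not_decreasing_iff_before[of "take u ?w"] d(2) by (meson distinct_take)
    then have c: "c < last (take u ?w)" "\<forall>b \<in> set (drop u ?w). c < b"
      using C unfolding C_site_def by blast+
    have "c \<in> set ?w"
      using cz by (meson before_in_set in_set_takeD)
    then have "c \<ge> 1" using p' unfolding is_perm_iff by auto
    moreover have "1 = last (take u ?w) \<or> 1 \<in> set (drop u ?w)"
    proof (cases "u = t + 1")
      case True
      then show ?thesis using w'(3) by (simp add: insert_smallest_def)
    next
      case False
      then have "u \<le> t" using that by simp
      then show ?thesis using w'(3) by (simp add: insert_smallest_def)
    qed
    ultimately show False using c by auto
  qed
  have "{u \<in> ?A. first_ascent_pos ?w \<le> u} = Suc ` {u \<in> A. t < u}"
  proof (intro set_eqI iffI)
    fix x assume "x \<in> {u \<in> ?A. first_ascent_pos ?w \<le> u}"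
    then have x: "x \<in> ?A" "first_ascent_pos ?w \<le> x" by auto
    have "t + 1 < x"
    proof (cases "t < r")
      case True then show ?thesis using x r' by simp
    next
      case False then show ?thesis using x r' inactive[of x] by fastforce
    qed
    then obtain u where "x = Suc u" "t < u" by (metis Suc_eq_plus1 Suc_lessE)
    then show "x \<in> Suc ` {u \<in> A. t < u}"
      using x active_sites_C_child[OF w t, of u] unfolding A_def by blast
  next
    fix x assume "x \<in> Suc ` {u \<in> A. t < u}"
    then show "x \<in> {u \<in> ?A. first_ascent_pos ?w \<le> u}"
      using active_sites_C_child[OF w t] r' unfolding A_def by auto
  qed
  then show ?thesis
    using r' by (simp add: label_C_def Let_def card_image)
qed

text \<open>Distinct sites give distinct children, so the labels of the set of children can be
  counted over the active sites.\<close>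

lemma image_mset_children:
  assumes "inj_on (\<lambda>t. ins t w) {..length w}"
  shows "image_mset lab (mset_set (children E ins w)) =
    image_mset (\<lambda>t. lab (ins t w)) (mset_set (active_sites E ins w))"
proof -
  have "inj_on (\<lambda>t. ins t w) (active_sites E ins w)"
    using assms by (rule inj_on_subset) (auto simp: active_sites_def)
  from image_mset_mset_set[OF this, symmetric] show ?thesis
    by (simp add: children_def image_mset.compositionality o_def)
qed

text \<open>The site is recovered as the number of letters before the 1.\<close>

lemma inj_insert_smallest:
  assumes "0 \<notin> set w"
  shows "inj_on (\<lambda>t. insert_smallest t w) {..length w}"
proof (rule inj_on_inverseI)
  fix t assume "t \<in> {..length w}"
  moreover have "takeWhile (\<lambda>x. x \<noteq> 1) (map Suc (take t w) @ 1 # z) = map Suc (take t w)" for z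
    using assms by (subst takeWhile_append2) (auto dest: in_set_takeD)
  ultimately show "length (takeWhile (\<lambda>x. x \<noteq> 1) (insert_smallest t w)) = t"
    by (simp add: insert_smallest_def)
qed

text \<open>Decreasing prefixes satisfy the site condition vacuously, so the first \<open>r\<close>
  active sites are those below \<open>r\<close>. Such a site \<open>t\<close> has rank
  \<open>t + 1\<close>, in line with the first entry \<open>t + 2\<close>, and all later sites have
  rank above \<open>r\<close>.\<close>

lemma class_C_succ_rule:
  assumes "w \<in> class_C"
  shows "image_mset label_C (mset_set (children class_C insert_smallest w)) = succ_rule (label_C w)"
proof -
  define A where "A = active_sites class_C insert_smallest w"
  define r where "r = first_ascent_pos w"
  define s where "s = card {t \<in> A. r \<le> t}"
  note p = class_C_is_perm[OF assms]
  have z: "0 \<notin> set w" and d: "distinct w" using p unfolding is_perm_iff by auto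
  have fin: "finite A" unfolding A_def active_sites_def by simp
  have fa: "j < r \<longleftrightarrow> j \<le> length w \<and> sorted_wrt (>) (take j w)" for j
    using sorted_wrt_take_first_ascent[OF p] unfolding r_def by blast
  have low: "{..<r} \<subseteq> A"
  proof
    fix t assume "t \<in> {..<r}"
    then have t: "t \<le> length w" "sorted_wrt (>) (take t w)" using fa by blast+
    then have "\<nexists>c z. before (take t w) c z \<and> c < z"
      using not_decreasing_iff_before d by (metis distinct_take)
    then show "t \<in> A"
      using t unfolding A_def active_sites_C[OF assms] C_site_def by blast
  qed
  have A: "A = {..<r} \<union> {t \<in> A. r \<le> t}"
    using low by auto
  have cA: "card A = r + s"
    unfolding s_def by (subst A, subst card_Un_disjoint) (use fin in auto)
  have "image_mset (\<lambda>t. label_C (insert_smallest t w)) (mset_set A) = succ_rule (r, s)"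
  proof (rule image_mset_rank_succ_rule[OF fin cA])
    fix t assume t: "t \<in> A"
    have l: "label_C (insert_smallest t w) = (if t < r then t + 2 else r, card {u \<in> A. t < u})"
      using label_C_child[OF assms t[unfolded A_def]] unfolding A_def r_def .
    then show "snd (label_C (insert_smallest t w)) = card {u \<in> A. t < u}" by simp
    show "fst (label_C (insert_smallest t w)) =
      (if card {u \<in> A. u \<le> t} \<le> r then card {u \<in> A. u \<le> t} + 1 else r)"
    proof (cases "t < r")
      case True
      then have "{u \<in> A. u \<le> t} = {..t}" using low by auto
      then show ?thesis using l True by simp
    next
      case False
      then have "insert t {..<r} \<subseteq> {u \<in> A. u \<le> t}" using low t by auto
      then have "card (insert t {..<r}) \<le> card {u \<in> A. u \<le> t}"
        using fin by (intro card_mono) auto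
      then show ?thesis using l False by simp
    qed
  qed
  moreover have "label_C w = (r, s)"
    by (simp add: label_C_def A_def s_def r_def Let_def)
  ultimately show ?thesis
    using image_mset_children[where ins = insert_smallest and lab = label_C and E = class_C, OF inj_insert_smallest[OF z]]
    by (simp add: A_def del: succ_rule.simps)
qed

section \<open>The generating tree of class D\<close>

text \<open>\<open>min\<close> and \<open>max\<close> treat both patterns at once: for adjacent
  letters \<open>x\<close>, \<open>y\<close> this is 2-14-3 or 2-41-3 according to their order, with
  \<open>a\<close> as the 2 and \<open>b\<close> as the 3.\<close>

definition separates :: "nat set \<Rightarrow> nat \<Rightarrow> nat \<Rightarrow> nat set \<Rightarrow> bool" where
  "separates A x y B \<longleftrightarrow> (\<exists>a \<in> A. \<exists>b \<in> B. min x y < a \<and> a < b \<and> b < max x y)"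

text \<open>The sets \<open>A\<close> and \<open>B\<close> hold the letters to the left and to the right of the factor \<open>w\<close> of a word.\<close>
fun no_separation :: "nat set \<Rightarrow> nat list \<Rightarrow> nat set \<Rightarrow> bool" where
  "no_separation A (x # y # w) B \<longleftrightarrow>
     \<not> separates A x y (set w \<union> B) \<and> no_separation (insert x A) (y # w) B"
| "no_separation A w B \<longleftrightarrow> True"

text \<open>An adjacent pair lies in \<open>u\<close>, in \<open>v\<close> or across the cut; each
  part joins the outer letters of the other.\<close>

lemma no_separation_append:
  assumes "u \<noteq> []" "v \<noteq> []"
  shows "no_separation A (u @ v) B \<longleftrightarrow>
    no_separation A u (set v \<union> B) \<and>
    \<not> separates (A \<union> set (butlast u)) (last u) (hd v) (set (tl v) \<union> B) \<and>
    no_separation (A \<union> set u) v B"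
  using assms
proof (induction A u B rule: no_separation.induct)
  case (1 A x y w B)
  then show ?case by (simp add: Un_assoc insert_commute)
next
  case ("2_2" A x B)
  then show ?case by (cases v) auto
qed auto

lemma no_separation_nth:
  "no_separation A w B \<longleftrightarrow>
    (\<forall>j. Suc j < length w \<longrightarrow>
      \<not> separates (A \<union> set (take j w)) (w ! j) (w ! Suc j) (set (drop (j + 2) w) \<union> B))"
proof (induction A w B rule: no_separation.induct)
  case (1 A x y w B)
  \<comment> \<open>Index 0 is the pair that the recursion splits off.\<close>
  have all: "(\<forall>j. Q j) \<longleftrightarrow> Q 0 \<and> (\<forall>j. Q (Suc j))" for Q
    by (metis not0_implies_Suc)
  show ?case
    by (subst all) (simp add: 1)
qed auto

lemma class_D_iff: "w \<in> class_D \<longleftrightarrow> is_perm w \<and> no_separation {} w {}"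
proof -
  have tk: "a \<in> set (take j w) \<longleftrightarrow> (\<exists>i < j. i < length w \<and> w ! i = a)" for a j
    by (auto simp: in_set_conv_nth)
  have dr: "b \<in> set (drop j w) \<longleftrightarrow> (\<exists>k \<ge> j. k < length w \<and> w ! k = b)" for b j
  proof
    assume "b \<in> set (drop j w)"
    then obtain i where "i < length w - j" "w ! (j + i) = b" by (auto simp: in_set_conv_nth)
    then show "\<exists>k \<ge> j. k < length w \<and> w ! k = b" by (intro exI[of _ "j + i"]) auto
  next
    assume "\<exists>k \<ge> j. k < length w \<and> w ! k = b"
    then obtain k where "j \<le> k" "k < length w" "w ! k = b" by blast
    then show "b \<in> set (drop j w)"
      by (auto simp: in_set_conv_nth intro!: exI[of _ "k - j"])
  qed
  have "contains_2_14_3 w \<or> contains_2_41_3 w \<longleftrightarrow>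
    (\<exists>j. Suc j < length w \<and> separates (set (take j w)) (w ! j) (w ! Suc j) (set (drop (j + 2) w)))"
    (is "?l \<longleftrightarrow> ?r")
  proof
    assume ?l
    then obtain i j k where ijk: "i < j" "j + 1 < k" "k < length w"
      and "w ! j < w ! i \<and> w ! i < w ! k \<and> w ! k < w ! (j + 1) \<or>
           w ! (j + 1) < w ! i \<and> w ! i < w ! k \<and> w ! k < w ! j"
      unfolding contains_2_14_3_def contains_2_41_3_def by blast
    then have lt: "min (w ! j) (w ! Suc j) < w ! i" "w ! i < w ! k" "w ! k < max (w ! j) (w ! Suc j)"
      by auto
    have "w ! i \<in> set (take j w)"
      unfolding tk using ijk by auto
    moreover have "w ! k \<in> set (drop (j + 2) w)"
      unfolding dr using ijk by (intro exI[of _ k]) simp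
    ultimately have "separates (set (take j w)) (w ! j) (w ! Suc j) (set (drop (j + 2) w))"
      unfolding separates_def using lt by blast
    then show ?r using ijk by (intro exI[of _ j]) simp
  next
    assume ?r
    then obtain j a b where "a \<in> set (take j w)" "b \<in> set (drop (j + 2) w)"
      and ab: "min (w ! j) (w ! Suc j) < a" "a < b" "b < max (w ! j) (w ! Suc j)"
      unfolding separates_def by blast
    then obtain i k where i: "i < j" "w ! i = a" and k: "j + 2 \<le> k" "k < length w" "w ! k = b"
      unfolding tk dr by blast
    note ijk = i(1) k(1,2)
    have lt: "min (w ! j) (w ! Suc j) < w ! i" "w ! i < w ! k" "w ! k < max (w ! j) (w ! Suc j)"
      using ab i k by auto
    have jk: "j + 1 < k" using ijk by simp
    show ?l
    proof (cases "w ! j < w ! Suc j")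
      case True
      then have "w ! j < w ! i \<and> w ! i < w ! k \<and> w ! k < w ! (j + 1)" using lt by simp
      then show ?thesis unfolding contains_2_14_3_def using ijk jk by blast
    next
      case False
      then have "w ! (j + 1) < w ! i \<and> w ! i < w ! k \<and> w ! k < w ! j" using lt by simp
      then show ?thesis unfolding contains_2_41_3_def using ijk jk by blast
    qed
  qed
  then show ?thesis
    unfolding class_D_def no_separation_nth by auto
qed

text \<open>Both separating letters lie below some letter of \<open>w\<close>, so \<open>N\<close>
  can be neither of them.\<close>

lemma no_separation_insert_right:
  assumes "\<forall>x \<in> set w. x < N"
  shows "no_separation A w (insert N B) \<longleftrightarrow> no_separation A w B"
  using assms
  by (induction A w B rule: no_separation.induct) (auto simp: separates_def max_def min_def)

lemma no_separation_insert_left: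
  assumes "\<forall>x \<in> set w. x < N"
  shows "no_separation (insert N A) w B \<longleftrightarrow> no_separation A w B"
  using assms
  by (induction A w B rule: no_separation.induct)
    (auto simp: separates_def max_def min_def insert_commute)

text \<open>The conjuncts concern the two adjacent pairs that the inserted maximum forms with
  \<open>last u\<close> and \<open>hd v\<close>. Being below the maximum is automatic, so only the
  lower bound appears.\<close>

definition D_site :: "nat list \<Rightarrow> nat list \<Rightarrow> bool" where
  "D_site u v \<longleftrightarrow>
    (u \<noteq> [] \<longrightarrow> (\<forall>a \<in> set (butlast u). \<forall>b \<in> set v. \<not> (last u < a \<and> a < b))) \<and>
    (v \<noteq> [] \<longrightarrow> (\<forall>a \<in> set u. \<forall>b \<in> set (tl v). \<not> (hd v < a \<and> a < b)))"

text \<open>The pair \<open>last u\<close>, \<open>hd v\<close> is replaced by two pairs with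
  \<open>N\<close>, and the remaining pairs are not affected by \<open>N\<close> as an outer
  letter.\<close>

lemma no_separation_insert_largest:
  assumes "\<forall>x \<in> set (u @ v). x < N"
  shows "no_separation {} (u @ N # v) {} \<longleftrightarrow> no_separation {} (u @ v) {} \<and> D_site u v"
proof -
  have sep_l: "separates A x N B \<longleftrightarrow> (\<exists>a \<in> A. \<exists>b \<in> B. x < a \<and> a < b)" if "x < N" "\<forall>b \<in> B. b < N" for A x B
    using that by (auto simp: separates_def)
  have sep_r: "separates A N x B \<longleftrightarrow> (\<exists>a \<in> A. \<exists>b \<in> B. x < a \<and> a < b)" if "x < N" "\<forall>b \<in> B. b < N" for A x B
    using that by (auto simp: separates_def)
  have left: "no_separation A (N # v) {} \<longleftrightarrow>
      no_separation A v {} \<and> (v \<noteq> [] \<longrightarrow> (\<forall>a \<in> A. \<forall>b \<in> set (tl v). \<not> (hd v < a \<and> a < b)))" for A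
  proof (cases v)
    case (Cons y v')
    then show ?thesis
      using assms no_separation_insert_left[of v N A "{}"] sep_r[of y "set v'" A] by auto
  qed simp
  show ?thesis
  proof (cases "u = []")
    case True
    then show ?thesis using left[of "{}"] by (simp add: D_site_def)
  next
    case False
    then have lN: "last u < N" using assms by simp
    have "no_separation {} (u @ N # v) {} \<longleftrightarrow>
        no_separation {} u (set v) \<and>
        (\<forall>a \<in> set (butlast u). \<forall>b \<in> set v. \<not> (last u < a \<and> a < b)) \<and>
        no_separation (set u) (N # v) {}"
      using no_separation_append[OF False, of "N # v" "{}" "{}"] assms lN
        no_separation_insert_right[of u N "{}" "set v"] sep_l[of "last u" "set v" "set (butlast u)"]
      by auto
    also have "\<dots> \<longleftrightarrow> no_separation {} u (set v) \<and> no_separation (set u) v {} \<and> D_site u v"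
      using left[of "set u"] False by (auto simp: D_site_def)
    also have "\<dots> \<longleftrightarrow> no_separation {} (u @ v) {} \<and> D_site u v"
    proof (cases "v = []")
      case True
      then show ?thesis by simp
    next
      case v: False
      \<comment> \<open>A separation of the replaced pair has \<open>last u\<close> or
        \<open>hd v\<close> below \<open>a\<close>, and would thus separate one of the new
        pairs.\<close>
      have "\<not> separates (set (butlast u)) (last u) (hd v) (set (tl v))" if "D_site u v"
      proof
        assume "separates (set (butlast u)) (last u) (hd v) (set (tl v))"
        then obtain a b where "a \<in> set (butlast u)" "b \<in> set (tl v)"
          "min (last u) (hd v) < a" "a < b"
          unfolding separates_def by blast
        moreover have "a \<in> set u" "b \<in> set v"
          using calculation v by (auto dest: in_set_butlastD list.set_sel(2))
        ultimately show False
          using that False v unfolding D_site_def by (metis min_less_iff_disj)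
      qed
      then show ?thesis
        using no_separation_append[OF False v, of "{}" "{}"] by auto
    qed
    finally show ?thesis .
  qed
qed

section \<open>Active sites and labels in class D\<close>

lemma is_perm_insert_largest_iff:
  assumes "N = Suc (length (u @ v))"
  shows "is_perm (u @ N # v) \<longleftrightarrow> is_perm (u @ v)"
proof -
  have "{1..N} = insert N {1..length (u @ v)}" "N \<notin> {1..length (u @ v)}"
    using assms by auto
  moreover have "length (u @ N # v) = N" "set (u @ N # v) = insert N (set (u @ v))"
    using assms by auto
  moreover have "distinct (u @ N # v) \<longleftrightarrow> N \<notin> set (u @ v) \<and> distinct (u @ v)"
    by auto
  moreover have "N \<notin> set (u @ v)" if "distinct (u @ N # v)" using that by auto
  ultimately show ?thesis
    unfolding is_perm_iff by (metis insert_ident)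
qed

lemma is_perm_less: "is_perm w \<Longrightarrow> x \<in> set w \<Longrightarrow> x < Suc (length w)"
  unfolding is_perm_iff by auto

lemma class_D_insert_largest_iff:
  assumes "is_perm (u @ v)" "N = Suc (length (u @ v))"
  shows "u @ N # v \<in> class_D \<longleftrightarrow> u @ v \<in> class_D \<and> D_site u v"
proof -
  have "\<forall>x \<in> set (u @ v). x < N"
    using is_perm_less[OF assms(1)] assms(2) by blast
  then show ?thesis
    unfolding class_D_iff is_perm_insert_largest_iff[OF assms(2)]
    using no_separation_insert_largest[of u v N] assms(1) by blast
qed

lemma perm_split_largest:
  assumes "is_perm w" "w \<noteq> []"
  obtains u v where "w = u @ length w # v" "is_perm (u @ v)" "\<forall>x \<in> set (u @ v). x < length w"
proof -
  have "length w \<in> set w" using assms unfolding is_perm_iff by (auto simp: Suc_le_eq)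
  then obtain u v where w: "w = u @ length w # v" by (meson split_list)
  then have len: "length w = Suc (length (u @ v))"
    by (metis add_Suc_right length_Cons length_append)
  have "is_perm (u @ v)"
    using is_perm_insert_largest_iff[OF len] assms(1) w by metis
  then show ?thesis using that w len is_perm_less by metis
qed

lemma class_D_is_perm: "w \<in> class_D \<Longrightarrow> is_perm w"
  by (simp add: class_D_def)

lemma class_D_delete_largest:
  assumes "w \<in> class_D" "w \<noteq> []"
  shows "delete_largest w \<in> class_D"
proof -
  obtain u v where w: "w = u @ length w # v" and uv: "is_perm (u @ v)" "\<forall>x \<in> set (u @ v). x < length w"
    using perm_split_largest[OF class_D_is_perm[OF assms(1)] assms(2)] .
  have len: "length w = Suc (length (u @ v))"
    by (subst w) simp
  define N where "N = length w"
  have "filter (\<lambda>x. x \<noteq> N) u = u" "filter (\<lambda>x. x \<noteq> N) v = v"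
    using uv(2) unfolding N_def by (auto intro!: filter_True)
  moreover have w': "w = u @ N # v" using w N_def by simp
  ultimately have "delete_largest w = u @ v"
    unfolding delete_largest_def N_def[symmetric] by simp
  moreover have "u @ N # v \<in> class_D" using assms(1) w' by (rule subst[rotated])
  then have "u @ v \<in> class_D"
    using class_D_insert_largest_iff[OF uv(1) len[folded N_def]] by blast
  ultimately show ?thesis by simp
qed

lemma length_insert_largest: "length (insert_largest t w) = Suc (length w)"
  by (auto simp: insert_largest_def)

lemma active_sites_D:
  assumes "w \<in> class_D"
  shows "active_sites class_D insert_largest w = {t. t \<le> length w \<and> D_site (take t w) (drop t w)}"
proof -
  have "insert_largest t w \<in> class_D \<longleftrightarrow> D_site (take t w) (drop t w)" for t
    using class_D_insert_largest_iff[of "take t w" "drop t w"] class_D_is_perm[OF assms] assms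
    by (simp add: insert_largest_def)
  then show ?thesis by (auto simp: active_sites_def)
qed

text \<open>As \<open>a\<close>, the letter \<open>N\<close> would need a larger \<open>b\<close>. A
  nonempty \<open>v1\<close> keeps the neighbours of the site unchanged.\<close>

lemma D_site_right_of_largest:
  assumes "\<forall>x \<in> set (u @ v1 @ v2). x < N" "v1 \<noteq> []"
  shows "D_site (u @ N # v1) v2 \<longleftrightarrow> D_site (u @ v1) v2"
proof -
  have "set (tl v2) \<subseteq> set v2" by (cases v2) auto
  then have "\<forall>b \<in> set v2. \<not> N < b" "\<forall>b \<in> set (tl v2). \<not> N < b"
    using assms(1) by (auto simp: not_less intro: less_imp_le)
  then show ?thesis
    using assms unfolding D_site_def by (auto simp: butlast_append)
qed

text \<open>No letter exceeds the left neighbour \<open>N\<close>, and the condition on the right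
  neighbour is inherited from the old site.\<close>

lemma D_site_after_largest:
  assumes "\<forall>x \<in> set (u @ v). x < N" "D_site u v"
  shows "D_site (u @ [N]) v"
proof -
  have "set (tl v) \<subseteq> set v" by (cases v) auto
  then have "\<forall>a \<in> set u. \<not> N < a" "\<forall>b \<in> set (tl v). \<not> N < b"
    using assms(1) by (auto simp: not_less intro: less_imp_le)
  then show ?thesis
    using assms(2) unfolding D_site_def by (simp add: butlast_append)
qed

text \<open>
  Site \<open>j\<close> is bounded by left-to-right maxima, where only the first \<open>t\<close> letters of \<open>w\<close> are considered,
  so that site \<open>t\<close> has no right neighbour.
\<close>
definition lr_site :: "nat list \<Rightarrow> nat \<Rightarrow> nat \<Rightarrow> bool" where
  "lr_site w t j \<longleftrightarrow> (0 < j \<longrightarrow> (\<forall>a \<in> set (take j w). a \<le> w ! (j - 1))) \<and>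
    (j < t \<longrightarrow> (\<forall>a \<in> set (take j w). a \<le> w ! j))"

text \<open>To the right of the site, \<open>N\<close> can serve as \<open>b\<close> for every
  \<open>a\<close>, so no earlier letter may exceed a neighbour of the site. For empty
  \<open>u2\<close> the right neighbour is \<open>N\<close> itself, which nothing exceeds.\<close>

lemma D_site_left_of_largest:
  assumes "\<forall>x \<in> set (u1 @ u2 @ v). x < N"
  shows "D_site u1 (u2 @ N # v) \<longleftrightarrow>
    (u1 \<noteq> [] \<longrightarrow> (\<forall>a \<in> set u1. a \<le> last u1)) \<and> (u2 \<noteq> [] \<longrightarrow> (\<forall>a \<in> set u1. a \<le> hd u2))"
proof -
  have 1: "(\<forall>a \<in> set (butlast u1). \<forall>b \<in> set (u2 @ N # v). \<not> (last u1 < a \<and> a < b)) \<longleftrightarrow>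
      (\<forall>a \<in> set u1. a \<le> last u1)" if "u1 \<noteq> []"
  proof -
    have u1: "set u1 = insert (last u1) (set (butlast u1))"
      using that by (metis append_butlast_last_id list.simps(15) rotate1.simps(2) set_rotate1)
    have "a < N" if "a \<in> set (butlast u1)" for a
      using that assms by (auto dest: in_set_butlastD)
    then show ?thesis
      unfolding u1 by (fastforce simp: not_less)
  qed
  have 2: "(\<forall>a \<in> set u1. \<forall>b \<in> set (tl (u2 @ N # v)). \<not> (hd (u2 @ N # v) < a \<and> a < b)) \<longleftrightarrow>
      (u2 \<noteq> [] \<longrightarrow> (\<forall>a \<in> set u1. a \<le> hd u2))"
  proof (cases u2)
    case Nil
    then show ?thesis using assms by (auto dest: less_asym)
  next
    case (Cons y u2')
    then show ?thesis using assms by (auto simp: not_less) (metis Un_iff leD)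
  qed
  show ?thesis
    unfolding D_site_def using 1 2 by simp
qed

lemma D_site_left_of_largest_nth:
  assumes "\<forall>x \<in> set (take t w @ v). x < N" "j \<le> t" "t \<le> length w"
  shows "D_site (take j w) (drop j (take t w) @ N # v) \<longleftrightarrow> lr_site w t j"
proof -
  have "take j w @ drop j (take t w) = take t w"
    using assms(2) by (metis append_take_drop_id min.absorb1 take_take)
  then have "\<forall>x \<in> set (take j w @ drop j (take t w) @ v). x < N"
    using assms(1) by (metis append.assoc)
  from D_site_left_of_largest[OF this] show ?thesis
    using assms(2,3) unfolding lr_site_def
    by (auto simp: last_conv_nth hd_drop_conv_nth min_def)
qed

text \<open>Here \<open>m\<close> is the 0-based index of the largest letter, so the sites to its
  left are \<open>0\<close> to \<open>m\<close>.\<close>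

lemma active_sites_D_left:
  assumes "w \<in> class_D" "w = take m w @ length w # v" "m \<le> length w"
    "\<forall>x \<in> set (take m w @ v). x < length w"
  shows "{j \<in> active_sites class_D insert_largest w. j \<le> m} = {j. j \<le> m \<and> lr_site w m j}"
proof -
  have "D_site (take j w) (drop j w) \<longleftrightarrow> lr_site w m j" if "j \<le> m" for j
  proof -
    have "drop j w = drop j (take m w @ length w # v)" using assms(2) by simp
    also have "\<dots> = drop j (take m w) @ length w # v" using that assms(3) by simp
    finally show ?thesis
      using D_site_left_of_largest_nth[OF assms(4) that assms(3)] by simp
  qed
  then show ?thesis
    unfolding active_sites_D[OF assms(1)] using assms(3) by auto
qed

text \<open>Since \<open>pos\<close> is 1-based, the largest letter has position
  \<open>Suc m\<close>, and sites below it are those up to \<open>m\<close>.\<close>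

lemma label_D_eq:
  assumes "w \<in> class_D" "w = take m w @ length w # v" "m \<le> length w"
    "\<forall>x \<in> set (take m w @ v). x < length w"
  defines "A \<equiv> active_sites class_D insert_largest w"
  shows "label_D w = (1 + card {j \<in> A. j \<le> m}, card {j \<in> A. m < j} - 1)"
proof -
  define u where "u = take m w"
  define N where "N = length w"
  have w: "w = u @ N # v" "length u = m" "\<forall>x \<in> set u. x \<noteq> N"
    using assms(2-4) unfolding u_def N_def by auto
  have "takeWhile (\<lambda>x. x \<noteq> N) (u @ N # v) = u"
    using w(3) by (simp add: takeWhile_append2)
  then have "pos w N = Suc m"
    unfolding pos_def using w by simp
  then show ?thesis
    unfolding label_D_def Let_def N_def A_def by (simp add: less_Suc_eq_le Suc_le_eq)
qed

lemma insert_largest_take: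
  assumes "t \<le> length w" "j \<le> t"
  shows "take j (insert_largest t w) = take j w"
    and "drop j (insert_largest t w) = drop j (take t w) @ Suc (length w) # drop t w"
  using assms by (simp_all add: insert_largest_def)

lemma inj_insert_largest:
  assumes "Suc (length w) \<notin> set w"
  shows "inj_on (\<lambda>t. insert_largest t w) {..length w}"
proof (rule inj_on_inverseI)
  fix t assume "t \<in> {..length w}"
  moreover have "takeWhile (\<lambda>x. x \<noteq> Suc (length w)) (take t w @ Suc (length w) # z) = take t w" for z
    using assms by (subst takeWhile_append2) (auto dest: in_set_takeD)
  ultimately show "length (takeWhile (\<lambda>x. x \<noteq> Suc (length w)) (insert_largest t w)) = t"
    by (simp add: insert_largest_def)
qed

text \<open>In contrast to class C, \<open>u = t\<close> is included: the site right after the new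
  letter is active.\<close>

lemma active_sites_D_child:
  assumes "w \<in> class_D" "t \<in> active_sites class_D insert_largest w" "t \<le> u"
  shows "Suc u \<in> active_sites class_D insert_largest (insert_largest t w) \<longleftrightarrow>
    u \<in> active_sites class_D insert_largest w"
proof (cases "u \<le> length w")
  case True
  have w': "insert_largest t w \<in> class_D" "t \<le> length w" "D_site (take t w) (drop t w)"
    using assms(1,2) active_sites_D[OF assms(1)] by (auto simp: active_sites_def)
  let ?N = "Suc (length w)"
  let ?u1 = "take t w" let ?u2 = "take (u - t) (drop t w)" let ?v = "drop u w"
  have tk: "take u w = ?u1 @ ?u2"
    using assms(3) take_add[of t "u - t" w] by simp
  have w: "w = ?u1 @ ?u2 @ ?v"
    using tk by (metis append.assoc append_take_drop_id)
  have dr: "drop t w = ?u2 @ ?v"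
    using w w'(2) by (metis append_take_drop_id same_append_eq)
  have lt: "\<forall>x \<in> set (?u1 @ ?u2 @ ?v). x < ?N"
    using is_perm_less[OF class_D_is_perm[OF assms(1)]] w by metis
  have iw: "insert_largest t w = (?u1 @ ?N # ?u2) @ ?v"
    using dr by (simp add: insert_largest_def)
  have "length (?u1 @ ?N # ?u2) = Suc u"
    using assms(3) True by simp
  then have split: "take (Suc u) (insert_largest t w) = ?u1 @ ?N # ?u2"
    "drop (Suc u) (insert_largest t w) = ?v"
    unfolding iw by (metis append_eq_conv_conj)+
  have "D_site (?u1 @ ?N # ?u2) ?v \<longleftrightarrow> D_site (take u w) ?v"
  proof (cases "?u2 = []")
    case False
    then show ?thesis using D_site_right_of_largest[OF lt] tk by simp
  next
    case True
    then have "u = t" using assms(3) \<open>u \<le> length w\<close> w'(2) by auto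
    then show ?thesis
      using D_site_after_largest[of ?u1 ?v ?N] lt w'(3) by simp
  qed
  then show ?thesis
    using split True by (simp add: active_sites_D[OF assms(1)] active_sites_D[OF w'(1)] length_insert_largest)
next
  case False
  then show ?thesis by (simp add: active_sites_def length_insert_largest)
qed

text \<open>To the right of the new letter, the active sites are the shifts of those from
  \<open>t\<close> on; the 1 subtracted in the label accounts for the shift of \<open>t\<close>
  itself.\<close>

lemma label_D_child:
  assumes w: "w \<in> class_D" and t: "t \<in> active_sites class_D insert_largest w"
  defines "A \<equiv> active_sites class_D insert_largest w"
  shows "label_D (insert_largest t w) =
    (1 + card {j. j \<le> t \<and> lr_site w t j}, card {u \<in> A. t < u})"
proof -
  let ?w = "insert_largest t w" let ?A = "active_sites class_D insert_largest ?w"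
  have w': "?w \<in> class_D" "t \<le> length w"
    using t by (auto simp: active_sites_def)
  note p = class_D_is_perm[OF w]
  have lt: "\<forall>x \<in> set (take t w @ drop t w). x < Suc (length w)"
    using is_perm_less[OF p] by simp
  have split: "?w = take t ?w @ length ?w # drop t w"
    using w'(2) by (simp add: insert_largest_def)
  have lt': "\<forall>x \<in> set (take t ?w @ drop t w). x < length ?w"
    using lt insert_largest_take(1)[OF w'(2), of t] by (simp add: length_insert_largest)
  have l: "label_D ?w = (1 + card {j \<in> ?A. j \<le> t}, card {j \<in> ?A. t < j} - 1)"
    using w'(2) by (intro label_D_eq[OF w'(1) split _ lt']) (simp add: length_insert_largest)
  have "D_site (take j ?w) (drop j ?w) \<longleftrightarrow> lr_site w t j" if "j \<le> t" for j
    using D_site_left_of_largest_nth[OF lt that w'(2)] insert_largest_take[OF w'(2) that] by simp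
  then have left: "{j \<in> ?A. j \<le> t} = {j. j \<le> t \<and> lr_site w t j}"
    unfolding active_sites_D[OF w'(1)] using w'(2) by (auto simp: length_insert_largest)
  have "{j \<in> ?A. t < j} = Suc ` {u \<in> A. t \<le> u}"
  proof (intro set_eqI iffI)
    fix x assume x: "x \<in> {j \<in> ?A. t < j}"
    then obtain u where "x = Suc u" "t \<le> u" by (auto elim: less_natE)
    then show "x \<in> Suc ` {u \<in> A. t \<le> u}"
      using x active_sites_D_child[OF w t, of u] unfolding A_def by blast
  next
    fix x assume "x \<in> Suc ` {u \<in> A. t \<le> u}"
    then show "x \<in> {j \<in> ?A. t < j}"
      using active_sites_D_child[OF w t] unfolding A_def by auto
  qed
  also have "{u \<in> A. t \<le> u} = insert t {u \<in> A. t < u}"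
    using t unfolding A_def by auto
  finally have "card {j \<in> ?A. t < j} = card (insert t {u \<in> A. t < u})"
    by (simp only: card_image inj_Suc)
  also have "\<dots> = Suc (card {u \<in> A. t < u})"
    by (simp add: A_def active_sites_def)
  finally have "card {j \<in> ?A. t < j} = Suc (card {u \<in> A. t < u})" .
  then show ?thesis using l left by simp
qed

text \<open>Among the \<open>r + s\<close> active sites, \<open>r - 1\<close> lie left of the
  largest letter and the \<open>r\<close>-th is right after it. If \<open>t\<close> is at most the
  latter, all active sites up to \<open>t\<close> remain active left of the new letter; if
  \<open>t\<close> is beyond it, only the \<open>r - 1\<close> sites left of the old maximum
  do.\<close>

lemma class_D_succ_rule:
  assumes "w \<in> class_D" "w \<noteq> []"
  shows "image_mset label_D (mset_set (children class_D insert_largest w)) = succ_rule (label_D w)"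
proof -
  define A where "A = active_sites class_D insert_largest w"
  note p = class_D_is_perm[OF assms(1)]
  have fin: "finite A" unfolding A_def active_sites_def by simp
  obtain u v where w: "w = u @ length w # v" and uv: "is_perm (u @ v)"
    and lt: "\<forall>x \<in> set (u @ v). x < length w"
    using perm_split_largest[OF p assms(2)] .
  define m where "m = length u"
  have len: "length w = Suc (length (u @ v))" by (subst w) simp
  then have m: "m < length w" unfolding m_def by simp
  have tk: "take m w = u" by (subst w) (simp add: m_def)
  have nm: "w ! m = length w" by (subst w) (simp add: m_def)
  have less: "a < length w" if "a \<in> set (take m w)" for a
    using that lt tk by simp
  have other: "w ! j < length w" if "j < length w" "j \<noteq> m" for j
  proof -
    have "w ! j \<noteq> w ! m"
      using p that m unfolding is_perm_iff by (simp add: nth_eq_iff_index_eq)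
    moreover have "w ! j < Suc (length w)" using is_perm_less[OF p] that by simp
    ultimately show ?thesis using nm by simp
  qed
  have w2: "w = take m w @ length w # v" using w tk by simp
  have lt2: "\<forall>x \<in> set (take m w @ v). x < length w" using lt tk by simp
  define r where "r = 1 + card {j \<in> A. j \<le> m}"
  define s where "s = card {j \<in> A. m < j} - 1"
  have lab: "label_D w = (r, s)"
    unfolding r_def s_def A_def using m by (intro label_D_eq[OF assms(1) w2 _ lt2]) simp
  have left: "{j \<in> A. j \<le> m} = {j. j \<le> m \<and> lr_site w m j}"
    unfolding A_def using m by (intro active_sites_D_left[OF assms(1) w2 _ lt2]) simp
  \<comment> \<open>This makes the count of sites beyond \<open>m\<close> positive, so the
    subtraction in \<open>s\<close> does not truncate.\<close>
  have after: "Suc m \<in> A"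
  proof -
    have "D_site u v"
      using class_D_insert_largest_iff[OF uv len] assms(1) w by simp
    then have "D_site (u @ [length w]) v" using D_site_after_largest lt by blast
    moreover have "take (Suc m) w = u @ [length w]" "drop (Suc m) w = v"
      by (subst w, simp add: m_def)+
    ultimately show ?thesis
      unfolding A_def active_sites_D[OF assms(1)] using m by simp
  qed
  have "A = {j \<in> A. j \<le> m} \<union> {j \<in> A. m < j}" by auto
  then have "card A = card {j \<in> A. j \<le> m} + card {j \<in> A. m < j}"
    using fin by (subst card_Un_disjoint[symmetric]) auto
  moreover have "card {j \<in> A. m < j} > 0"
    using after fin by (auto simp: card_gt_0_iff)
  ultimately have cA: "card A = r + s" unfolding r_def s_def by simp
  have "image_mset (\<lambda>t. label_D (insert_largest t w)) (mset_set A) = succ_rule (r, s)"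
  proof (rule image_mset_rank_succ_rule[OF fin cA])
    fix t assume t: "t \<in> A"
    have l: "label_D (insert_largest t w) =
        (1 + card {j. j \<le> t \<and> lr_site w t j}, card {u \<in> A. t < u})"
      using label_D_child[OF assms(1) t[unfolded A_def]] unfolding A_def .
    then show "snd (label_D (insert_largest t w)) = card {u \<in> A. t < u}" by simp
    have tw: "t \<le> length w" using t unfolding A_def active_sites_def by simp
    \<comment> \<open>Only site \<open>m\<close> gains a right neighbour, and this is the maximum,
      which nothing exceeds.\<close>
    have above: "lr_site w t j \<longleftrightarrow> lr_site w m j" if "m < t" "j \<le> m" for j
      using that less nm unfolding lr_site_def by (cases "j = m") (auto intro: less_imp_le)
    show "fst (label_D (insert_largest t w)) =
      (if card {u \<in> A. u \<le> t} \<le> r then card {u \<in> A. u \<le> t} + 1 else r)"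
    proof (cases "t \<le> Suc m")
      case True
      have "{j. j \<le> t \<and> lr_site w t j} = {u \<in> A. u \<le> t}"
      proof (cases "t \<le> m")
        case True
        have "lr_site w m t" using t left True by blast
        \<comment> \<open>The two conditions can differ only at \<open>j = t\<close>, where both
          hold because site \<open>t\<close> is active.\<close>
        then have "lr_site w t j \<longleftrightarrow> lr_site w m j" if "j \<le> t" for j
          using that True unfolding lr_site_def by (cases "j = t") auto
        then have "{j. j \<le> t \<and> lr_site w t j} = {j. j \<le> m \<and> lr_site w m j} \<inter> {..t}"
          using True by auto
        also have "\<dots> = {u \<in> A. u \<le> t}" unfolding left[symmetric] using True by auto
        finally show ?thesis .
      next
        case False
        then have tm: "t = Suc m" using \<open>t \<le> Suc m\<close> by simp
        have "lr_site w t t"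
          unfolding lr_site_def using tm nm less m
          by (auto simp: take_Suc_conv_app_nth intro: less_imp_le)
        then have "{j. j \<le> t \<and> lr_site w t j} = insert t {j. j \<le> m \<and> lr_site w m j}"
          using above tm by (auto simp: le_Suc_eq)
        also have "\<dots> = {u \<in> A. u \<le> t}"
          unfolding left[symmetric] using tm after by (auto simp: le_Suc_eq)
        finally show ?thesis .
      qed
      moreover have "card {u \<in> A. u \<le> t} \<le> card (insert (Suc m) {j \<in> A. j \<le> m})"
        using fin True by (intro card_mono) (auto simp: le_Suc_eq)
      then have "card {u \<in> A. u \<le> t} \<le> r"
        using fin unfolding r_def by simp
      ultimately show ?thesis using l by simp
    next
      case False
      \<comment> \<open>The maximum stands before site \<open>j\<close> and exceeds a neighbour of
        it: the left one if \<open>j > Suc m\<close>, the right one if \<open>j = Suc m\<close>,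
        which counts because \<open>Suc m < t\<close>.\<close>
      have "\<not> lr_site w t j" if "m < j" "j \<le> t" for j
      proof
        assume lr: "lr_site w t j"
        have "w ! m \<in> set (take j w)"
          using that(1) m tw that(2) by (auto simp: in_set_conv_nth intro!: exI[of _ m])
        then have "length w \<le> w ! (j - 1)" "j < t \<longrightarrow> length w \<le> w ! j"
          using lr that unfolding lr_site_def nm by auto
        moreover have "j = Suc m \<Longrightarrow> w ! j < length w \<and> j < t"
          using other[of j] False tw by simp
        moreover have "j \<noteq> Suc m \<Longrightarrow> w ! (j - 1) < length w"
          using other[of "j - 1"] that tw by simp
        ultimately show False by fastforce
      qed
      then have "j \<le> t \<and> lr_site w t j \<longleftrightarrow> j \<le> m \<and> lr_site w m j" for j
        using above[of j] False by (cases "j \<le> m") auto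
      then have "{j. j \<le> t \<and> lr_site w t j} = {j \<in> A. j \<le> m}" using left by simp
      then have f: "fst (label_D (insert_largest t w)) = r" using l r_def by simp
      have "card (insert (Suc m) (insert t {j \<in> A. j \<le> m})) \<le> card {u \<in> A. u \<le> t}"
        using fin t after False by (intro card_mono) auto
      then have "card {u \<in> A. u \<le> t} > r"
        using fin False unfolding r_def by (simp add: card_insert_if)
      then show ?thesis using f by simp
    qed
  qed
  moreover have "Suc (length w) \<notin> set w"
    using is_perm_less[OF p] by blast
  ultimately show ?thesis
    using image_mset_children[where ins = insert_largest and lab = label_D and E = class_D, OF inj_insert_largest, of w] lab
    by (simp add: A_def del: succ_rule.simps)
qed

section \<open>Both trees\<close>

lemma described_by_generating_tree:
  assumes "[1] \<in> E" "lab [1] = root_label"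
    and "\<And>w. w \<in> E \<Longrightarrow> w \<noteq> [] \<Longrightarrow>
      image_mset lab (mset_set (children E ins w)) = rewr (lab w)"
    and "\<And>t w. ins t w \<noteq> []"
  shows "described_by (generating_tree E ins) lab root_label rewr"
proof -
  have "map_tree lab (grow (\<lambda>w. mset_set (children E ins w)) [1]) = grow rewr (lab [1])"
  \<comment> \<open>The label rule is assumed for nonempty words only; these are closed under
    children, as insertion never yields the empty word.\<close>
  proof (rule map_tree_grow[where X="E - {[]}"])
    fix w
    show "set_mset (mset_set (children E ins w)) \<subseteq> E - {[]}"
      using assms(4) by (auto simp: children_def active_sites_def)
  qed (use assms in auto)
  then show ?thesis by (simp only: described_by_def generating_tree_def assms(2))
qed

lemma is_perm_singleton: "is_perm [1]"
  by (auto simp: is_perm_iff)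

lemma singleton_class_C: "[1] \<in> class_C" and label_C_singleton: "label_C [1] = (2, 0)"
proof -
  show C: "[1] \<in> class_C"
    unfolding class_C_iff stack_inversion_def by (simp add: is_perm_singleton[simplified])
  have "first_ascent_pos [1] = 2"
    by (simp add: first_ascent_pos_def id_perm_def)
  \<comment> \<open>The only sites are 0 and 1, so none is at position 2 or later.\<close>
  then show "label_C [1] = (2, 0)"
    by (auto simp: label_C_def active_sites_def Let_def)
qed

lemma singleton_class_D: "[1] \<in> class_D" and label_D_singleton: "label_D [1] = (2, 0)"
proof -
  show D: "[1] \<in> class_D"
    unfolding class_D_iff using is_perm_singleton by simp
  have A: "active_sites class_D insert_largest [1] = {0, 1}"
    unfolding active_sites_D[OF D] by (auto simp: D_site_def le_Suc_eq)
  have "pos [1] (length [1::nat]) = 1"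
    by (simp add: pos_def)
  moreover have "{t \<in> {0, 1::nat}. t < 1} = {0}" "{t \<in> {0, 1::nat}. 1 \<le> t} = {1}"
    by auto
  ultimately show "label_D [1] = (2, 0)"
    unfolding label_D_def Let_def A by (simp only: card.insert finite.emptyI card.empty) simp
qed

theorem theorem4p1:
  shows
    "(\<forall>w \<in> class_C. length w \<ge> 2 \<longrightarrow> delete_smallest w \<in> class_C) \<and>
     [1] \<in> class_C \<and> label_C [1] = (2, 0) \<and>
     (\<forall>w \<in> class_C.
        image_mset label_C (mset_set (children class_C insert_smallest w)) =
        succ_rule (label_C w)) \<and>
     (\<forall>w \<in> class_D. length w \<ge> 2 \<longrightarrow> delete_largest w \<in> class_D) \<and>
     [1] \<in> class_D \<and> label_D [1] = (2, 0) \<and>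
     (\<forall>w \<in> class_D. w \<noteq> [] \<longrightarrow>
        image_mset label_D (mset_set (children class_D insert_largest w)) =
        succ_rule (label_D w)) \<and>
     described_by (generating_tree class_C insert_smallest) label_C (2, 0) succ_rule \<and>
     described_by (generating_tree class_D insert_largest) label_D (2, 0) succ_rule"
proof (intro conjI ballI impI)
  show "delete_smallest w \<in> class_C" if "w \<in> class_C" "2 \<le> length w" for w
    using that by (intro class_C_delete_smallest) auto
  show "delete_largest w \<in> class_D" if "w \<in> class_D" "2 \<le> length w" for w
    using that by (intro class_D_delete_largest) auto
  show "described_by (generating_tree class_C insert_smallest) label_C (2, 0) succ_rule"
    by (intro described_by_generating_tree singleton_class_C label_C_singleton class_C_succ_rule)
      (simp_all add: insert_smallest_def)
  show "described_by (generating_tree class_D insert_largest) label_D (2, 0) succ_rule"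
    by (intro described_by_generating_tree singleton_class_D label_D_singleton class_D_succ_rule)
      (simp_all add: insert_largest_def)
qed (fact singleton_class_C singleton_class_D label_C_singleton label_D_singleton
    | erule class_C_succ_rule | erule (1) class_D_succ_rule)+

end
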